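(* Given an (axiomatically defined) parallel transport $\mathsf P$ in a bundle $(E,\pi,M)$, there exists a unique connection $\Delta^h$ on $(E,\pi,M)$ generating it. Besides, the parallel transport assigned to $\Delta^h$ coincides with $\mathsf P$.
   Context: $\mathbb K=\mathbb R$ or $\mathbb C$. $(E,\pi,M)$ is a bundle with projection $\pi\colon E\to M$; $M$ and $E$ are $C^1$ manifolds over $\mathbb K$ of finite dimensions $n\ge 1$ and $n+r$, $r\ge 1$. $J$ denotes an arbitrary real interval, $[\sigma,\tau]$ a closed one. Paths are $C^1$ maps from real intervals (one-sided derivatives at closed endpoints; intervals nondegenerate wherever a tangent vector is taken); an identity involving a product path is asserted whenever the product is again such a path. The inverse of $\gamma\colon[0,1]\to M$ is $\gamma_-(t)=\gamma(1-t)$; if $\gamma_1(1)=\gamma_2(0)$, the product $\gamma_1\gamma_2\colon[0,1]\to M$ is $\gamma_1(2t)$ for $t\in[0,1/2]$ and $\gamma_2(2t-1)$ for $t\in[1/2,1]$. (Axiomatically defined) parallel transport: a map $\mathsf P$ assigning to each path $\gamma\colon[\sigma,\tau]\to M$ a map $\mathsf P^\gamma\colon\pi^{-1}(\gamma(\sigma))\to\pi^{-1}(\gamma(\tau))$ such that: (i) $\mathsf P^{\gamma\circ\chi}=\mathsf P^\gamma$ for every orientation preserving $C^1$ diffeomorphism $\chi\colon[\sigma',\tau']\to[\sigma,\tau]$; (ii) $\mathsf P^{\gamma_-}=(\mathsf P^\gamma)^{-1}$ for $\gamma\colon[0,1]\to M$; (iii) $\mathsf P^{\gamma_1\gamma_2}=\mathsf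 P^{\gamma_2}\circ\mathsf P^{\gamma_1}$ for $\gamma_1,\gamma_2\colon[0,1]\to M$ with $\gamma_1(1)=\gamma_2(0)$; (iv) $\mathsf P^{\gamma_{r,x}}=\mathrm{id}_{\pi^{-1}(x)}$ for $\gamma_{r,x}\colon\{r\}=[r,r]\to\{x\}$, $r\in\mathbb R$, $x\in M$; (v) with $\bar\gamma_p(s)=\mathsf P^{\gamma|[\sigma,s]}(p)$, $s\in[\sigma,\tau]$, $p\in\pi^{-1}(\gamma(\sigma))$: $\bar\gamma_p$ is $C^1$ for every $C^1$ path $\gamma$, and if $C^1$ paths $\gamma_i\colon[\sigma_i,\tau_i]\to M$, $i=1,2$, satisfy $\gamma_1(\sigma_1)=\gamma_2(\sigma_2)$ and $\dot\gamma_1(\sigma_1)=\dot\gamma_2(\sigma_2)$, then $\dot{\bar\gamma}_{1;p}(\sigma_1)=\dot{\bar\gamma}_{2;p}(\sigma_2)$; (vi) if $\gamma_i\colon[\sigma_i,\tau_i]\to M$, $i=1,2$, are $C^1$ with $\gamma_1(\sigma_1)=\gamma_2(\sigma_2)$, then for every $a_1,a_2\in\mathbb K$ there is a $C^1$ path $\gamma_3\colon[\sigma_3,\tau_3]\to M$ with $\gamma_3(\sigma_3)=\gamma_1(\sigma_1)$ and $\dot{\bar\gamma}_{3;p}(\sigma_3)=a_1\dot{\bar\gamma}_{1;p}(\sigma_1)+a_2\dot{\bar\gamma}_{2;p}(\sigma_2)$ for $p\in\pi^{-1}(\gamma_3(\sigma_3))$. Connection: an $n$-dimensional distribution $\Delta^h\colon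 p\mapsto\Delta^h_p\subseteq T_p(E)$ on $E$ with $\Delta^v_p\oplus\Delta^h_p=T_p(E)$ for all $p\in E$, where $\Delta^v_p=T_p(\pi^{-1}(\pi(p)))$. A horizontal lift of a $C^1$ path $\gamma\colon J\to M$ is a $C^1$ path $\bar\gamma\colon J\to E$ with $\pi\circ\bar\gamma=\gamma$ and $\dot{\bar\gamma}(s)\in\Delta^h_{\bar\gamma(s)}$ for all $s$. Connections are such that for each $\gamma$, $s_0\in J$, $p\in\pi^{-1}(\gamma(s_0))$ there is a unique horizontal lift with value $p$ at $s_0$. The parallel transport generated by (assigned to, defined by) $\Delta^h$ assigns to $\gamma\colon[\sigma,\tau]\to M$ the map $\pi^{-1}(\gamma(\sigma))\to\pi^{-1}(\gamma(\tau))$, $p\mapsto\bar\gamma_p(\tau)$, where $\bar\gamma_p$ is the horizontal lift of $\gamma$ with $\bar\gamma_p(\sigma)=p$. A connection generates $\mathsf P$ if the parallel transport generated by it is $\mathsf P$.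
   Formalization: Added assumption: any horizontal distribution to which all P-transported paths are tangent has unique horizontal lifts. The axioms do not imply this (transport y to (y^{1/3}+γ(τ)-γ(σ))^3 over ℝ), and it is necessary for a connection generating P to exist. *)

theory Defs
  imports "HOL-Analysis.Analysis" "HOL-Library.Function_Algebras"
begin

text \<open>
  The ground field is a type of sort \<open>{real_normed_field, euclidean_space}\<close>.  By the theorem of
  Frobenius such a type is isometrically isomorphic to \<open>real\<close> or to \<open>complex\<close>, and both
  are instances.  Parameters of paths are real in either case.
\<close>

section \<open>Manifolds of class $C^1$\<close>

text \<open>
  A matrix-valued derivative is linear over the ground field, so over \<open>complex\<close> the
  following means holomorphic.
\<close>

definition c1_on :: "('k::{real_normed_field,euclidean_space}^'a::finite) set \<Rightarrow> ('k^'a \<Rightarrow> 'k^'b::finite) \<Rightarrow> bool"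
  where "c1_on S f \<longleftrightarrow>
    (\<exists>J :: 'k^'a \<Rightarrow> 'k^'a^'b. continuous_on S J \<and> (\<forall>x\<in>S. (f has_derivative (\<lambda>v. J x *v v)) (at x)))"

type_synonym ('m,'k,'n) chart = "'m set \<times> ('m \<Rightarrow> 'k^'n)"

definition is_chart :: "('m::topological_space, 'k::{real_normed_field,euclidean_space}, 'n::finite) chart \<Rightarrow> bool"
  where "is_chart = (\<lambda>(U,\<phi>). open U \<and> open (\<phi> ` U) \<and> homeomorphism U (\<phi> ` U) \<phi> (inv_into U \<phi>))"

definition c1_compatible :: "('m, 'k::{real_normed_field,euclidean_space}, 'n::finite) chart \<Rightarrow> ('m,'k,'n) chart \<Rightarrow> bool"
  where "c1_compatible = (\<lambda>(U,\<phi>) (V,\<psi>).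
    c1_on (\<phi> ` (U \<inter> V)) (\<psi> \<circ> inv_into U \<phi>) \<and> c1_on (\<psi> ` (U \<inter> V)) (\<phi> \<circ> inv_into V \<psi>))"

text \<open>
  The manifold is the whole (Hausdorff) type; its dimension is \<open>CARD('n)\<close>.  The atlas need not be
  maximal, and second countability is not required.
\<close>

definition c1_manifold :: "('m::t2_space, 'k::{real_normed_field,euclidean_space}, 'n::finite) chart set \<Rightarrow> bool"
  where "c1_manifold A \<longleftrightarrow>
    (\<forall>c\<in>A. is_chart c) \<and> (\<forall>c\<in>A. \<forall>c'\<in>A. c1_compatible c c') \<and> \<Union>(fst ` A) = UNIV"

definition admissible_chart ::
  "('m::topological_space, 'k::{real_normed_field,euclidean_space}, 'n::finite) chart set \<Rightarrow> ('m,'k,'n) chart \<Rightarrow> bool"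
  where "admissible_chart A c \<longleftrightarrow> is_chart c \<and> (\<forall>c'\<in>A. c1_compatible c c')"


section \<open>Paths and tangent vectors\<close>

text \<open>
  A path is a map on \<open>real\<close> of which only the values on the interval \<open>J\<close> matter;
  derivatives are taken within \<open>J\<close>, hence are one-sided at closed endpoints.
  On \<open>J = {a}\<close> every map is a path.
\<close>

definition c1_path ::
  "('m::topological_space, 'k::{real_normed_field,euclidean_space}, 'n::finite) chart set \<Rightarrow> real set \<Rightarrow> (real \<Rightarrow> 'm) \<Rightarrow> bool"
  where "c1_path A J \<gamma> \<longleftrightarrow> is_interval J \<and> continuous_on J \<gamma> \<and>
    (\<forall>(U,\<phi>)\<in>A. \<exists>g. continuous_on {t\<in>J. \<gamma> t \<in> U} g \<and>
       (\<forall>t\<in>J. \<gamma> t \<in> U \<longrightarrow> ((\<lambda>s. \<phi> (\<gamma> s)) has_vector_derivative g t) (at t within J)))"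

text \<open>
  A tangent vector is the family of its components in all charts of the atlas around the point
  (and \<open>0\<close> at all other pairs), related by the Jacobians of the coordinate changes.
\<close>

definition tangent_space ::
  "('m, 'k::{real_normed_field,euclidean_space}, 'n::finite) chart set \<Rightarrow> 'm \<Rightarrow> (('m,'k,'n) chart \<Rightarrow> 'k^'n) set"
  where "tangent_space A x = {v.
    (\<forall>c. c \<notin> A \<or> x \<notin> fst c \<longrightarrow> v c = 0) \<and>
    (\<forall>(U,\<phi>)\<in>A. \<forall>(V,\<psi>)\<in>A. x \<in> U \<inter> V \<longrightarrow>
       v (V,\<psi>) = frechet_derivative (\<psi> \<circ> inv_into U \<phi>) (at (\<phi> x)) (v (U,\<phi>)))}"

definition velocity ::
  "('m, 'k::{real_normed_field,euclidean_space}, 'n::finite) chart set \<Rightarrow> real set \<Rightarrow> (real \<Rightarrow> 'm) \<Rightarrow> real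
    \<Rightarrow> ('m,'k,'n) chart \<Rightarrow> 'k^'n"
  where "velocity A J \<gamma> t = (\<lambda>(U,\<phi>).
    if (U,\<phi>) \<in> A \<and> \<gamma> t \<in> U then vector_derivative (\<lambda>s. \<phi> (\<gamma> s)) (at t within J) else 0)"

definition tscale :: "'k::field \<Rightarrow> ('c \<Rightarrow> 'k^'n) \<Rightarrow> 'c \<Rightarrow> 'k^'n::finite"
  where "tscale a v = (\<lambda>c. a *s v c)"

interpretation tangent: vector_space "tscale :: 'k::field \<Rightarrow> ('c \<Rightarrow> 'k^'n::finite) \<Rightarrow> 'c \<Rightarrow> 'k^'n"
  by unfold_locales (auto simp: tscale_def fun_eq_iff vec.scale_right_distrib vec.scale_left_distrib)


section \<open>Bundles\<close>

text \<open>
  Around every point of the total space there are bundle coordinates, i.e. coordinates whose first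
  \<open>n\<close> components are coordinates of the projected point.  Thus the projection is a surjective
  $C^1$ submersion and its fibres are $C^1$ submanifolds of dimension \<open>r\<close>; local triviality
  is not required.
\<close>

locale c1_bundle =
  fixes \<A>\<^sub>M :: "('m::t2_space, 'k::{real_normed_field,euclidean_space}, 'n::finite) chart set"
    and \<A>\<^sub>E :: "('e::t2_space, 'k, 'n + 'r::finite) chart set"
    and pr :: "'e \<Rightarrow> 'm"
  assumes manifold_base: "c1_manifold \<A>\<^sub>M"
    and manifold_total: "c1_manifold \<A>\<^sub>E"
    and surj_pr: "surj pr"
    and bundle_coordinates: "\<And>p. \<exists>U \<phi> V \<psi>. admissible_chart \<A>\<^sub>M (U,\<phi>) \<and> admissible_chart \<A>\<^sub>E (V,\<psi>) \<and>
      p \<in> V \<and> pr ` V \<subseteq> U \<and> (\<forall>q\<in>V. \<forall>i. \<psi> q $ Inl i = \<phi> (pr q) $ i)"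


section \<open>Parallel transports\<close>

definition c1_real_on :: "real set \<Rightarrow> (real \<Rightarrow> real) \<Rightarrow> bool"
  where "c1_real_on S f \<longleftrightarrow>
    (\<exists>f'. continuous_on S f' \<and> (\<forall>t\<in>S. (f has_real_derivative f' t) (at t within S)))"

definition orientation_preserving_diffeo :: "real \<Rightarrow> real \<Rightarrow> real \<Rightarrow> real \<Rightarrow> (real \<Rightarrow> real) \<Rightarrow> bool"
  where "orientation_preserving_diffeo \<sigma>' \<tau>' \<sigma> \<tau> \<theta> \<longleftrightarrow>
    bij_betw \<theta> {\<sigma>'..\<tau>'} {\<sigma>..\<tau>} \<and> c1_real_on {\<sigma>'..\<tau>'} \<theta> \<and>
    c1_real_on {\<sigma>..\<tau>} (inv_into {\<sigma>'..\<tau>'} \<theta>) \<and> strict_mono_on {\<sigma>'..\<tau>'} \<theta>"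

text \<open>
  \<open>P \<sigma> \<tau> \<gamma>\<close> is the transport along the path \<open>\<gamma>\<close> on \<open>{\<sigma>..\<tau>}\<close>; only its values on
  the fibre over \<open>\<gamma> \<sigma>\<close> matter.  The lifted path of \<open>\<gamma>\<close> through \<open>p\<close> transports along the
  restrictions of \<open>\<gamma>\<close>:
\<close>

definition transport_lift ::
  "(real \<Rightarrow> real \<Rightarrow> (real \<Rightarrow> 'm) \<Rightarrow> 'e \<Rightarrow> 'e) \<Rightarrow> real \<Rightarrow> (real \<Rightarrow> 'm) \<Rightarrow> 'e \<Rightarrow> real \<Rightarrow> 'e"
  where "transport_lift P \<sigma> \<gamma> p = (\<lambda>s. P \<sigma> s \<gamma> p)"

text \<open>
  The first two axioms say that \<open>P\<close> is well defined: it depends on the values of the path on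
  its interval only, and it maps fibres to fibres.
\<close>

locale parallel_transport = c1_bundle \<A>\<^sub>M \<A>\<^sub>E pr
  for \<A>\<^sub>M :: "('m::t2_space, 'k::{real_normed_field,euclidean_space}, 'n::finite) chart set"
    and \<A>\<^sub>E :: "('e::t2_space, 'k, 'n + 'r::finite) chart set"
    and pr :: "'e \<Rightarrow> 'm" +
  fixes P :: "real \<Rightarrow> real \<Rightarrow> (real \<Rightarrow> 'm) \<Rightarrow> 'e \<Rightarrow> 'e"
  assumes transport_cong: "\<And>\<sigma> \<tau> \<gamma> \<gamma>' p. \<lbrakk>\<sigma> \<le> \<tau>; c1_path \<A>\<^sub>M {\<sigma>..\<tau>} \<gamma>; \<forall>t\<in>{\<sigma>..\<tau>}. \<gamma>' t = \<gamma> t; pr p = \<gamma> \<sigma>\<rbrakk>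
        \<Longrightarrow> P \<sigma> \<tau> \<gamma>' p = P \<sigma> \<tau> \<gamma> p"
    and transport_fibre: "\<And>\<sigma> \<tau> \<gamma> p. \<lbrakk>\<sigma> \<le> \<tau>; c1_path \<A>\<^sub>M {\<sigma>..\<tau>} \<gamma>; pr p = \<gamma> \<sigma>\<rbrakk>
        \<Longrightarrow> pr (P \<sigma> \<tau> \<gamma> p) = \<gamma> \<tau>"
    and transport_reparam: "\<And>\<sigma> \<tau> \<sigma>' \<tau>' \<gamma> \<theta> p. \<lbrakk>\<sigma> \<le> \<tau>; \<sigma>' \<le> \<tau>'; c1_path \<A>\<^sub>M {\<sigma>..\<tau>} \<gamma>;
          orientation_preserving_diffeo \<sigma>' \<tau>' \<sigma> \<tau> \<theta>; pr p = \<gamma> \<sigma>\<rbrakk>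
        \<Longrightarrow> P \<sigma>' \<tau>' (\<gamma> \<circ> \<theta>) p = P \<sigma> \<tau> \<gamma> p"
    and transport_inverse: "\<And>\<gamma>. c1_path \<A>\<^sub>M {0..1} \<gamma> \<Longrightarrow>
          (\<forall>p. pr p = \<gamma> 0 \<longrightarrow> P 0 1 (reversepath \<gamma>) (P 0 1 \<gamma> p) = p) \<and>
          (\<forall>q. pr q = \<gamma> 1 \<longrightarrow> P 0 1 \<gamma> (P 0 1 (reversepath \<gamma>) q) = q)"
    and transport_product: "\<And>\<gamma>\<^sub>1 \<gamma>\<^sub>2 p. \<lbrakk>c1_path \<A>\<^sub>M {0..1} \<gamma>\<^sub>1; c1_path \<A>\<^sub>M {0..1} \<gamma>\<^sub>2; \<gamma>\<^sub>1 1 = \<gamma>\<^sub>2 0;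
          c1_path \<A>\<^sub>M {0..1} (\<gamma>\<^sub>1 +++ \<gamma>\<^sub>2); pr p = \<gamma>\<^sub>1 0\<rbrakk>
        \<Longrightarrow> P 0 1 (\<gamma>\<^sub>1 +++ \<gamma>\<^sub>2) p = P 0 1 \<gamma>\<^sub>2 (P 0 1 \<gamma>\<^sub>1 p)"
    and transport_point: "\<And>t x p. pr p = x \<Longrightarrow> P t t (\<lambda>_. x) p = p"
    and transport_lift_c1: "\<And>\<sigma> \<tau> \<gamma> p. \<lbrakk>\<sigma> \<le> \<tau>; c1_path \<A>\<^sub>M {\<sigma>..\<tau>} \<gamma>; pr p = \<gamma> \<sigma>\<rbrakk>
        \<Longrightarrow> c1_path \<A>\<^sub>E {\<sigma>..\<tau>} (transport_lift P \<sigma> \<gamma> p)"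
    and transport_lift_velocity: "\<And>\<sigma>\<^sub>1 \<tau>\<^sub>1 \<gamma>\<^sub>1 \<sigma>\<^sub>2 \<tau>\<^sub>2 \<gamma>\<^sub>2 p. \<lbrakk>\<sigma>\<^sub>1 < \<tau>\<^sub>1; c1_path \<A>\<^sub>M {\<sigma>\<^sub>1..\<tau>\<^sub>1} \<gamma>\<^sub>1;
          \<sigma>\<^sub>2 < \<tau>\<^sub>2; c1_path \<A>\<^sub>M {\<sigma>\<^sub>2..\<tau>\<^sub>2} \<gamma>\<^sub>2; \<gamma>\<^sub>1 \<sigma>\<^sub>1 = \<gamma>\<^sub>2 \<sigma>\<^sub>2;
          velocity \<A>\<^sub>M {\<sigma>\<^sub>1..\<tau>\<^sub>1} \<gamma>\<^sub>1 \<sigma>\<^sub>1 = velocity \<A>\<^sub>M {\<sigma>\<^sub>2..\<tau>\<^sub>2} \<gamma>\<^sub>2 \<sigma>\<^sub>2; pr p = \<gamma>\<^sub>1 \<sigma>\<^sub>1\<rbrakk>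
        \<Longrightarrow> velocity \<A>\<^sub>E {\<sigma>\<^sub>1..\<tau>\<^sub>1} (transport_lift P \<sigma>\<^sub>1 \<gamma>\<^sub>1 p) \<sigma>\<^sub>1 =
            velocity \<A>\<^sub>E {\<sigma>\<^sub>2..\<tau>\<^sub>2} (transport_lift P \<sigma>\<^sub>2 \<gamma>\<^sub>2 p) \<sigma>\<^sub>2"
    and transport_lift_combination: "\<And>\<sigma>\<^sub>1 \<tau>\<^sub>1 \<gamma>\<^sub>1 \<sigma>\<^sub>2 \<tau>\<^sub>2 \<gamma>\<^sub>2 (a\<^sub>1::'k) (a\<^sub>2::'k). \<lbrakk>\<sigma>\<^sub>1 < \<tau>\<^sub>1; c1_path \<A>\<^sub>M {\<sigma>\<^sub>1..\<tau>\<^sub>1} \<gamma>\<^sub>1;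
          \<sigma>\<^sub>2 < \<tau>\<^sub>2; c1_path \<A>\<^sub>M {\<sigma>\<^sub>2..\<tau>\<^sub>2} \<gamma>\<^sub>2; \<gamma>\<^sub>1 \<sigma>\<^sub>1 = \<gamma>\<^sub>2 \<sigma>\<^sub>2\<rbrakk>
        \<Longrightarrow> \<exists>\<sigma>\<^sub>3 \<tau>\<^sub>3 \<gamma>\<^sub>3. \<sigma>\<^sub>3 < \<tau>\<^sub>3 \<and> c1_path \<A>\<^sub>M {\<sigma>\<^sub>3..\<tau>\<^sub>3} \<gamma>\<^sub>3 \<and> \<gamma>\<^sub>3 \<sigma>\<^sub>3 = \<gamma>\<^sub>1 \<sigma>\<^sub>1 \<and>
              (\<forall>p. pr p = \<gamma>\<^sub>3 \<sigma>\<^sub>3 \<longrightarrow>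
                 velocity \<A>\<^sub>E {\<sigma>\<^sub>3..\<tau>\<^sub>3} (transport_lift P \<sigma>\<^sub>3 \<gamma>\<^sub>3 p) \<sigma>\<^sub>3 =
                 tscale a\<^sub>1 (velocity \<A>\<^sub>E {\<sigma>\<^sub>1..\<tau>\<^sub>1} (transport_lift P \<sigma>\<^sub>1 \<gamma>\<^sub>1 p) \<sigma>\<^sub>1) +
                 tscale a\<^sub>2 (velocity \<A>\<^sub>E {\<sigma>\<^sub>2..\<tau>\<^sub>2} (transport_lift P \<sigma>\<^sub>2 \<gamma>\<^sub>2 p) \<sigma>\<^sub>2))"


section \<open>Connections\<close>

text \<open>
  The tangent space of the fibre through \<open>p\<close>: velocities at \<open>p\<close> of the $C^1$ curves that stay
  in the fibre.
\<close>

definition vertical_space ::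
  "('e::topological_space, 'k::{real_normed_field,euclidean_space}, 'd::finite) chart set \<Rightarrow> ('e \<Rightarrow> 'm) \<Rightarrow> 'e
    \<Rightarrow> (('e,'k,'d) chart \<Rightarrow> 'k^'d) set"
  where "vertical_space \<A>\<^sub>E pr p = {velocity \<A>\<^sub>E {-\<epsilon><..<\<epsilon>} \<beta> 0 | \<beta> \<epsilon>.
    \<epsilon> > 0 \<and> c1_path \<A>\<^sub>E {-\<epsilon><..<\<epsilon>} \<beta> \<and> \<beta> 0 = p \<and> (\<forall>s\<in>{-\<epsilon><..<\<epsilon>}. pr (\<beta> s) = pr p)}"

definition horizontal_distribution ::
  "('e::topological_space, 'k::{real_normed_field,euclidean_space}, 'n::finite + 'r::finite) chart set \<Rightarrow> ('e \<Rightarrow> 'm)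
    \<Rightarrow> ('e \<Rightarrow> (('e, 'k, 'n + 'r) chart \<Rightarrow> 'k^('n + 'r)) set) \<Rightarrow> bool"
  where "horizontal_distribution \<A>\<^sub>E pr \<Delta> \<longleftrightarrow> (\<forall>p.
    tangent.subspace (\<Delta> p) \<and> \<Delta> p \<subseteq> tangent_space \<A>\<^sub>E p \<and> tangent.dim (\<Delta> p) = CARD('n) \<and>
    vertical_space \<A>\<^sub>E pr p \<inter> \<Delta> p = {0} \<and>
    {v + w | v w. v \<in> vertical_space \<A>\<^sub>E pr p \<and> w \<in> \<Delta> p} = tangent_space \<A>\<^sub>E p)"

definition horizontal_lift ::
  "('e::topological_space, 'k::{real_normed_field,euclidean_space}, 'd::finite) chart set \<Rightarrow> ('e \<Rightarrow> 'm)
    \<Rightarrow> ('e \<Rightarrow> (('e,'k,'d) chart \<Rightarrow> 'k^'d) set) \<Rightarrow> real set \<Rightarrow> (real \<Rightarrow> 'm) \<Rightarrow> (real \<Rightarrow> 'e) \<Rightarrow> bool"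
  where "horizontal_lift \<A>\<^sub>E pr \<Delta> J \<gamma> \<beta> \<longleftrightarrow>
    c1_path \<A>\<^sub>E J \<beta> \<and> (\<forall>s\<in>J. pr (\<beta> s) = \<gamma> s) \<and>
    (\<forall>s\<in>J. J \<noteq> {s} \<longrightarrow> velocity \<A>\<^sub>E J \<beta> s \<in> \<Delta> (\<beta> s))"

definition lifts_exist ::
  "('m::topological_space, 'k::{real_normed_field,euclidean_space}, 'n::finite) chart set
    \<Rightarrow> ('e::topological_space, 'k, 'd::finite) chart set \<Rightarrow> ('e \<Rightarrow> 'm)
    \<Rightarrow> ('e \<Rightarrow> (('e,'k,'d) chart \<Rightarrow> 'k^'d) set) \<Rightarrow> bool"
  where "lifts_exist \<A>\<^sub>M \<A>\<^sub>E pr \<Delta> \<longleftrightarrow>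
    (\<forall>J \<gamma> s\<^sub>0 p. c1_path \<A>\<^sub>M J \<gamma> \<and> s\<^sub>0 \<in> J \<and> pr p = \<gamma> s\<^sub>0 \<longrightarrow>
       (\<exists>\<beta>. horizontal_lift \<A>\<^sub>E pr \<Delta> J \<gamma> \<beta> \<and> \<beta> s\<^sub>0 = p))"

definition lifts_unique ::
  "('m::topological_space, 'k::{real_normed_field,euclidean_space}, 'n::finite) chart set
    \<Rightarrow> ('e::topological_space, 'k, 'd::finite) chart set \<Rightarrow> ('e \<Rightarrow> 'm)
    \<Rightarrow> ('e \<Rightarrow> (('e,'k,'d) chart \<Rightarrow> 'k^'d) set) \<Rightarrow> bool"
  where "lifts_unique \<A>\<^sub>M \<A>\<^sub>E pr \<Delta> \<longleftrightarrow>
    (\<forall>J \<gamma> s\<^sub>0 \<beta>\<^sub>1 \<beta>\<^sub>2. c1_path \<A>\<^sub>M J \<gamma> \<and> s\<^sub>0 \<in> J \<and>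
       horizontal_lift \<A>\<^sub>E pr \<Delta> J \<gamma> \<beta>\<^sub>1 \<and> horizontal_lift \<A>\<^sub>E pr \<Delta> J \<gamma> \<beta>\<^sub>2 \<and> \<beta>\<^sub>1 s\<^sub>0 = \<beta>\<^sub>2 s\<^sub>0 \<longrightarrow>
       (\<forall>s\<in>J. \<beta>\<^sub>1 s = \<beta>\<^sub>2 s))"

definition connection ::
  "('m::topological_space, 'k::{real_normed_field,euclidean_space}, 'n::finite) chart set
    \<Rightarrow> ('e::topological_space, 'k, 'n + 'r::finite) chart set \<Rightarrow> ('e \<Rightarrow> 'm)
    \<Rightarrow> ('e \<Rightarrow> (('e, 'k, 'n + 'r) chart \<Rightarrow> 'k^('n + 'r)) set) \<Rightarrow> bool"
  where "connection \<A>\<^sub>M \<A>\<^sub>E pr \<Delta> \<longleftrightarrow>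
    horizontal_distribution \<A>\<^sub>E pr \<Delta> \<and> lifts_exist \<A>\<^sub>M \<A>\<^sub>E pr \<Delta> \<and> lifts_unique \<A>\<^sub>M \<A>\<^sub>E pr \<Delta>"

definition generated_transport ::
  "('e::topological_space, 'k::{real_normed_field,euclidean_space}, 'd::finite) chart set \<Rightarrow> ('e \<Rightarrow> 'm)
    \<Rightarrow> ('e \<Rightarrow> (('e,'k,'d) chart \<Rightarrow> 'k^'d) set) \<Rightarrow> real \<Rightarrow> real \<Rightarrow> (real \<Rightarrow> 'm) \<Rightarrow> 'e \<Rightarrow> 'e"
  where "generated_transport \<A>\<^sub>E pr \<Delta> \<sigma> \<tau> \<gamma> p =
    (THE q. \<exists>\<beta>. horizontal_lift \<A>\<^sub>E pr \<Delta> {\<sigma>..\<tau>} \<gamma> \<beta> \<and> \<beta> \<sigma> = p \<and> \<beta> \<tau> = q)"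

definition generates ::
  "('m::topological_space, 'k::{real_normed_field,euclidean_space}, 'n::finite) chart set
    \<Rightarrow> ('e::topological_space, 'k, 'd::finite) chart set \<Rightarrow> ('e \<Rightarrow> 'm)
    \<Rightarrow> ('e \<Rightarrow> (('e,'k,'d) chart \<Rightarrow> 'k^'d) set)
    \<Rightarrow> (real \<Rightarrow> real \<Rightarrow> (real \<Rightarrow> 'm) \<Rightarrow> 'e \<Rightarrow> 'e) \<Rightarrow> bool"
  where "generates \<A>\<^sub>M \<A>\<^sub>E pr \<Delta> P \<longleftrightarrow>
    (\<forall>\<sigma> \<tau> \<gamma> p. \<sigma> \<le> \<tau> \<and> c1_path \<A>\<^sub>M {\<sigma>..\<tau>} \<gamma> \<and> pr p = \<gamma> \<sigma> \<longrightarrow>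
       generated_transport \<A>\<^sub>E pr \<Delta> \<sigma> \<tau> \<gamma> p = P \<sigma> \<tau> \<gamma> p)"

text \<open>
  The paths lifted by \<open>P\<close> are horizontal for \<open>\<Delta>\<close>.  This predicate states the standing
  convention on uniqueness of horizontal lifts for the one distribution to which it matters.  The
  axioms do not imply that uniqueness, because they impose no regularity in \<open>p\<close>: over the real
  line, with fibre the real line, transport \<open>y\<close> along \<open>\<gamma>\<close> to the cube of
  \<open>root 3 y + \<gamma> \<tau> - \<gamma> \<sigma>\<close>; then both \<open>t \<mapsto> (t, t ^ 3)\<close> and \<open>t \<mapsto> (t, 0)\<close> are
  horizontal lifts of the identity path.
\<close>

definition carries_transport ::
  "('m::topological_space, 'k::{real_normed_field,euclidean_space}, 'n::finite) chart set
    \<Rightarrow> ('e::topological_space, 'k, 'd::finite) chart set \<Rightarrow> ('e \<Rightarrow> 'm)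
    \<Rightarrow> ('e \<Rightarrow> (('e,'k,'d) chart \<Rightarrow> 'k^'d) set)
    \<Rightarrow> (real \<Rightarrow> real \<Rightarrow> (real \<Rightarrow> 'm) \<Rightarrow> 'e \<Rightarrow> 'e) \<Rightarrow> bool"
  where "carries_transport \<A>\<^sub>M \<A>\<^sub>E pr \<Delta> P \<longleftrightarrow>
    (\<forall>\<sigma> \<tau> \<gamma> p. \<sigma> \<le> \<tau> \<and> c1_path \<A>\<^sub>M {\<sigma>..\<tau>} \<gamma> \<and> pr p = \<gamma> \<sigma> \<longrightarrow>
       horizontal_lift \<A>\<^sub>E pr \<Delta> {\<sigma>..\<tau>} \<gamma> (transport_lift P \<sigma> \<gamma> p))"

end

theory Submission
  imports Defs
begin

text \<open>
  The horizontal space at \<open>p\<close> is the set of initial velocities of the transported paths through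
  \<open>p\<close>.  Axiom (vi) makes it a subspace.  In bundle coordinates the first components of such a velocity
  are the components of the velocity of the base path, which may be prescribed arbitrarily; if they
  vanish, axiom (v) compares the path with a constant one, whose transport \<open>Q\<close> is the identity by
  \<open>Q \<circ> Q = Q\<close> and \<open>Q \<circ> Q = id\<close>.  So the horizontal space projects isomorphically onto the tangent
  space of the base and complements the vertical space.

  Transported paths are horizontal at each parameter \<open>s < \<tau>\<close> because the transport up to \<open>t > s\<close>
  factors through \<open>s\<close>, and at the right endpoint by reversing the path.  On an arbitrary interval a
  lift arises by transporting forwards and backwards from the given point; on every compact
  subinterval it agrees with a path transported from the left endpoint, hence is smooth there.
  A connection generating the transport has the transported paths as its lifts, hence contains all
  horizontal spaces, and equals them since both complement the vertical space.
\<close>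

section \<open>Charts and tangent vectors in coordinates\<close>

text \<open>The argument is the point \<open>x\<close> rather than its coordinates, so that three
  charts can be compared at one point. A Frechet derivative is a priori only real linear; linearity
  over the ground field comes from the Jacobian matrix in \<open>c1_on\<close>.\<close>

definition transition ::
  "('m::topological_space, 'k::{real_normed_field,euclidean_space}, 'n::finite) chart \<Rightarrow> ('m,'k,'n) chart
    \<Rightarrow> 'm \<Rightarrow> 'k^'n \<Rightarrow> 'k^'n"
  where "transition c d x = frechet_derivative (snd d \<circ> inv_into (fst c) (snd c)) (at (snd c x))"

text \<open>The chart \<open>c\<close> need not belong to the atlas: bundle coordinates are merely admissible.\<close>

definition tangent_of ::
  "('m::topological_space, 'k::{real_normed_field,euclidean_space}, 'n::finite) chart set \<Rightarrow> ('m,'k,'n) chart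
    \<Rightarrow> 'm \<Rightarrow> 'k^'n \<Rightarrow> ('m,'k,'n) chart \<Rightarrow> 'k^'n"
  where "tangent_of A c x \<xi> = (\<lambda>d. if d \<in> A \<and> x \<in> fst d then transition c d x \<xi> else 0)"

lemma is_chart_iff:
  "is_chart c \<longleftrightarrow> open (fst c) \<and> open (snd c ` fst c) \<and>
     homeomorphism (fst c) (snd c ` fst c) (snd c) (inv_into (fst c) (snd c))"
  by (cases c) (simp add: is_chart_def)

lemma chart_inv [simp]:
  assumes "is_chart c" "x \<in> fst c"
  shows "inv_into (fst c) (snd c) (snd c x) = x"
  using assms by (metis homeomorphism_apply1 is_chart_iff)

lemma chart_inj: "is_chart c \<Longrightarrow> inj_on (snd c) (fst c)"
  by (rule inj_on_inverseI[of _ "inv_into (fst c) (snd c)"]) simp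

lemma chart_inv_continuous:
  "is_chart c \<Longrightarrow> continuous_on (snd c ` fst c) (inv_into (fst c) (snd c))"
  unfolding is_chart_iff by (blast intro: homeomorphism_cont2)

lemma chart_open: "is_chart c \<Longrightarrow> open (fst c)" "is_chart c \<Longrightarrow> open (snd c ` fst c)"
  unfolding is_chart_iff by blast+

text \<open>A chart is a homeomorphism onto an open set, so relatively open subsets of its image are
  open. This supplies the neighbourhoods on which composed coordinate changes may be
  rewritten.\<close>

lemma chart_open_image:
  assumes "is_chart c" "open S"
  shows "open (snd c ` (fst c \<inter> S))"
proof -
  have h: "homeomorphism (fst c) (snd c ` fst c) (snd c) (inv_into (fst c) (snd c))"
    and o: "open (snd c ` fst c)"
    using assms(1) unfolding is_chart_iff by blast+
  have "openin (top_of_set (snd c ` fst c)) (snd c ` (fst c \<inter> S))"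
    using homeomorphism_imp_open_map[OF h] assms(2) by (simp add: openin_open_Int)
  then show ?thesis
    using o openin_open_eq by blast
qed

text \<open>Derivatives at a point are unique, so the matrix field provided by \<open>c1_on\<close>
  represents \<open>transition\<close>. Continuity in the base point and linearity over the ground
  field are both read off from it.\<close>

lemma compatible_transition:
  assumes "is_chart c" "is_chart d" "c1_compatible c d"
  obtains J where "continuous_on (snd c ` (fst c \<inter> fst d)) J"
    and "\<And>x. x \<in> fst c \<Longrightarrow> x \<in> fst d \<Longrightarrow>
          ((snd d \<circ> inv_into (fst c) (snd c)) has_derivative transition c d x) (at (snd c x))"
    and "\<And>x. x \<in> fst c \<Longrightarrow> x \<in> fst d \<Longrightarrow> transition c d x = (\<lambda>v. J (snd c x) *v v)"
proof -
  have "c1_on (snd c ` (fst c \<inter> fst d)) (snd d \<circ> inv_into (fst c) (snd c))"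
    using assms(3) by (auto simp: c1_compatible_def split: prod.splits)
  then obtain J where J: "continuous_on (snd c ` (fst c \<inter> fst d)) J"
    and D: "\<And>y. y \<in> snd c ` (fst c \<inter> fst d) \<Longrightarrow>
        ((snd d \<circ> inv_into (fst c) (snd c)) has_derivative (\<lambda>v. J y *v v)) (at y)"
    by (auto simp: c1_on_def)
  have T: "transition c d x = (\<lambda>v. J (snd c x) *v v)" if "x \<in> fst c" "x \<in> fst d" for x
    unfolding transition_def using D[of "snd c x"] that by (auto intro!: frechet_derivative_at[symmetric])
  show thesis
    using that[OF J _ T] D T by auto
qed

lemma transition_derivative:
  assumes "is_chart c" "is_chart d" "c1_compatible c d" "x \<in> fst c" "x \<in> fst d"
  shows "((snd d \<circ> inv_into (fst c) (snd c)) has_derivative transition c d x) (at (snd c x))"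
  using compatible_transition[OF assms(1-3)] assms(4,5) by metis

lemma transition_linear:
  assumes "is_chart c" "is_chart d" "c1_compatible c d" "x \<in> fst c" "x \<in> fst d"
  shows "transition c d x (u + v) = transition c d x u + transition c d x v"
    and "transition c d x (a *s u) = a *s transition c d x u"
  using compatible_transition[OF assms(1-3)] assms(4,5)
  by (metis matrix_vector_right_distrib, metis vector_scalar_commute)

lemma transition_eqI:
  "((snd d \<circ> inv_into (fst c) (snd c)) has_derivative D) (at (snd c x)) \<Longrightarrow> transition c d x = D"
  unfolding transition_def by (rule frechet_derivative_at[symmetric])

text \<open>This is the chain rule. The composed coordinate change agrees with the direct one only
  on the image of the overlap of \<open>a\<close> and \<open>b\<close>, which is open. Taking
  \<open>c = a\<close> shows that transitions are invertible.\<close>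

lemma transition_cocycle:
  assumes "is_chart a" "is_chart b" "is_chart c" "c1_compatible a b" "c1_compatible b c"
    and x: "x \<in> fst a" "x \<in> fst b" "x \<in> fst c"
  shows "transition a c x \<xi> = transition b c x (transition a b x \<xi>)"
proof -
  let ?ia = "inv_into (fst a) (snd a)" and ?ib = "inv_into (fst b) (snd b)"
  have ab: "((snd b \<circ> ?ia) has_derivative transition a b x) (at (snd a x))"
    using assms by (intro transition_derivative)
  have bc: "((snd c \<circ> ?ib) has_derivative transition b c x) (at ((snd b \<circ> ?ia) (snd a x)))"
    using assms by (auto intro: transition_derivative)
  have "(((snd c \<circ> ?ib) \<circ> (snd b \<circ> ?ia)) has_derivative (transition b c x \<circ> transition a b x)) (at (snd a x))"
    by (rule diff_chain_at[OF ab bc])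
  then have "((snd c \<circ> ?ia) has_derivative (transition b c x \<circ> transition a b x)) (at (snd a x))"
  proof (rule has_derivative_transform_within_open)
    show "open (snd a ` (fst a \<inter> fst b))"
      using assms by (intro chart_open_image chart_open)
  qed (use assms in auto)
  then show ?thesis
    by (simp add: transition_eqI)
qed

lemma transition_self:
  assumes "is_chart c" "x \<in> fst c"
  shows "transition c c x \<xi> = \<xi>"
proof -
  have "((\<lambda>y. y) has_derivative (\<lambda>v. v)) (at (snd c x))"
    by simp
  then have "((snd c \<circ> inv_into (fst c) (snd c)) has_derivative (\<lambda>v. v)) (at (snd c x))"
    by (rule has_derivative_transform_within_open[where s = "snd c ` fst c"])
      (use assms chart_open[of c] in auto)
  then show ?thesis
    by (simp add: transition_eqI)
qed

lemma c1_compatible_sym: "c1_compatible c d \<Longrightarrow> c1_compatible d c"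
  by (auto simp: c1_compatible_def Int_commute split: prod.splits)

lemma manifoldD:
  assumes "c1_manifold A"
  shows "c \<in> A \<Longrightarrow> is_chart c"
    and "c \<in> A \<Longrightarrow> d \<in> A \<Longrightarrow> c1_compatible c d"
  using assms by (auto simp: c1_manifold_def)

lemma manifold_chart:
  assumes "c1_manifold A"
  obtains c where "c \<in> A" "x \<in> fst c"
  using assms unfolding c1_manifold_def by blast

lemma admissibleD:
  assumes "admissible_chart A c"
  shows "is_chart c" and "d \<in> A \<Longrightarrow> c1_compatible c d" and "d \<in> A \<Longrightarrow> c1_compatible d c"
  using assms by (auto simp: admissible_chart_def c1_compatible_sym)

lemma admissible_member: "c1_manifold A \<Longrightarrow> c \<in> A \<Longrightarrow> admissible_chart A c"
  by (auto simp: admissible_chart_def c1_manifold_def)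

lemma tangent_of_linear:
  assumes "c1_manifold A" "admissible_chart A c" "x \<in> fst c"
  shows "tangent_of A c x (\<xi> + \<eta>) = tangent_of A c x \<xi> + tangent_of A c x \<eta>"
    and "tangent_of A c x (a *s \<xi>) = tscale a (tangent_of A c x \<xi>)"
  using assms
  by (auto simp: tangent_of_def fun_eq_iff tscale_def transition_linear manifoldD admissibleD)

text \<open>Going to an atlas chart \<open>d\<close> and back is the identity by the cocycle rule,
  so the component at \<open>d\<close> already determines the coordinate vector.\<close>

lemma inj_tangent_of:
  assumes M: "c1_manifold A" and c: "admissible_chart A c" "x \<in> fst c"
  shows "inj (tangent_of A c x)"
proof (rule injI)
  fix \<xi> \<eta> assume eq: "tangent_of A c x \<xi> = tangent_of A c x \<eta>"
  obtain d where d: "d \<in> A" "x \<in> fst d" using manifold_chart[OF M] by blast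
  have "transition d c x (transition c d x \<zeta>) = \<zeta>" for \<zeta>
    using transition_cocycle[of c d c x \<zeta>] transition_self[of c x \<zeta>] d c manifoldD[OF M] admissibleD[OF c(1)]
    by auto
  moreover have "transition c d x \<xi> = transition c d x \<eta>"
    using fun_cong[OF eq, of d] d by (simp add: tangent_of_def)
  ultimately show "\<xi> = \<eta>" by metis
qed

lemma tangent_space_iff:
  "v \<in> tangent_space A x \<longleftrightarrow>
     (\<forall>c. c \<notin> A \<or> x \<notin> fst c \<longrightarrow> v c = 0) \<and>
     (\<forall>c\<in>A. \<forall>d\<in>A. x \<in> fst c \<longrightarrow> x \<in> fst d \<longrightarrow> v d = transition c d x (v c))"
  unfolding tangent_space_def transition_def by (simp add: split_beta) blast

text \<open>By the cocycle rule a compatible family of components is determined by its value in one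
  chart, and any value extends to such a family. Thus bundle coordinates can be used for
  computations in tangent spaces.\<close>

lemma tangent_space_eq_range:
  assumes M: "c1_manifold A" and c: "admissible_chart A c" "x \<in> fst c"
  shows "tangent_space A x = range (tangent_of A c x)"
proof safe
  fix \<xi>
  have "transition d e x (transition c d x \<xi>) = transition c e x \<xi>"
    if "d \<in> A" "x \<in> fst d" "e \<in> A" "x \<in> fst e" for d e
    using transition_cocycle[of c d e x \<xi>] that c manifoldD[OF M] admissibleD[OF c(1)] by auto
  then show "tangent_of A c x \<xi> \<in> tangent_space A x"
    unfolding tangent_space_iff by (simp add: tangent_of_def)
next
  fix v assume v: "v \<in> tangent_space A x"
  obtain d where d: "d \<in> A" "x \<in> fst d" using manifold_chart[OF M] by blast
  have "v = tangent_of A c x (transition d c x (v d))"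
  proof
    fix e
    show "v e = tangent_of A c x (transition d c x (v d)) e"
    proof (cases "e \<in> A \<and> x \<in> fst e")
      case True
      have "v e = transition d e x (v d)"
        using v True d unfolding tangent_space_iff by blast
      also have "\<dots> = transition c e x (transition d c x (v d))"
        using transition_cocycle[of d c e x] True d c manifoldD[OF M] admissibleD[OF c(1)] by auto
      finally show ?thesis using True by (simp add: tangent_of_def)
    next
      case False
      moreover have "v e = 0" using v False unfolding tangent_space_iff by blast
      ultimately show ?thesis by (auto simp: tangent_of_def)
    qed
  qed
  then show "v \<in> range (tangent_of A c x)" by blast
qed

section \<open>Paths in coordinates\<close>

text \<open>A connected set with more than one point accumulates at each of its points. Hence
  derivatives within a nondegenerate interval are unique, also at its endpoints.\<close>

lemma at_within_interval_not_bot: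
  fixes J :: "real set"
  assumes "is_interval J" "t \<in> J" "J \<noteq> {t}"
  shows "at t within J \<noteq> bot"
proof -
  have "connected J" using assms(1) by (simp add: is_interval_connected_1)
  then have "t islimpt J"
    using assms(2,3) connected_imp_perfect[of J t] by auto
  then show ?thesis by (simp add: trivial_limit_within)
qed

text \<open>Chain rule for the coordinate change. The path lies in the domain of \<open>c\<close>
  only near \<open>t\<close>, by continuity, so the two coordinate expressions are compared only
  eventually.\<close>

lemma chart_derivative_change:
  assumes "is_chart c" "is_chart d" "c1_compatible c d"
    and \<gamma>: "continuous (at t within J) \<gamma>" and t: "t \<in> J" "\<gamma> t \<in> fst c" "\<gamma> t \<in> fst d"
    and D: "((\<lambda>s. snd c (\<gamma> s)) has_vector_derivative \<xi>) (at t within J)"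
  shows "((\<lambda>s. snd d (\<gamma> s)) has_vector_derivative transition c d (\<gamma> t) \<xi>) (at t within J)"
proof -
  let ?f = "snd d \<circ> inv_into (fst c) (snd c)"
  have "(?f has_derivative transition c d (\<gamma> t)) (at (snd c (\<gamma> t)))"
    using assms by (intro transition_derivative)
  from vector_derivative_diff_chain_within[OF D has_derivative_at_withinI[OF this]]
  have "((?f \<circ> (\<lambda>s. snd c (\<gamma> s))) has_vector_derivative transition c d (\<gamma> t) \<xi>) (at t within J)" .
  moreover have "\<forall>\<^sub>F s in at t within J. (?f \<circ> (\<lambda>s. snd c (\<gamma> s))) s = snd d (\<gamma> s)"
  proof -
    have "\<forall>\<^sub>F s in at t within J. \<gamma> s \<in> fst c"
      using \<gamma> t(2) assms(1) by (auto simp: continuous_within dest: topological_tendstoD[OF _ chart_open(1)])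
    then show ?thesis
      by eventually_elim (use assms in auto)
  qed
  ultimately show ?thesis
    unfolding has_vector_derivative_def
    by (rule has_derivative_transform_eventually) (use assms in auto)
qed

lemma c1_pathD:
  assumes "c1_path A J \<gamma>"
  shows "is_interval J" "continuous_on J \<gamma>"
    and "c \<in> A \<Longrightarrow> \<exists>g. continuous_on {t\<in>J. \<gamma> t \<in> fst c} g \<and>
       (\<forall>t\<in>J. \<gamma> t \<in> fst c \<longrightarrow> ((\<lambda>s. snd c (\<gamma> s)) has_vector_derivative g t) (at t within J))"
  using assms unfolding c1_path_def by (auto simp: split_beta)

lemma c1_pathI:
  assumes "is_interval J" "continuous_on J \<gamma>"
    and "\<And>c. c \<in> A \<Longrightarrow> \<exists>g. continuous_on {t\<in>J. \<gamma> t \<in> fst c} g \<and>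
       (\<forall>t\<in>J. \<gamma> t \<in> fst c \<longrightarrow> ((\<lambda>s. snd c (\<gamma> s)) has_vector_derivative g t) (at t within J))"
  shows "c1_path A J \<gamma>"
  using assms unfolding c1_path_def by (auto simp: split_beta)

lemma path_chart_derivative:
  assumes M: "c1_manifold A" and \<gamma>: "c1_path A J \<gamma>" and c: "admissible_chart A c"
    and t: "t \<in> J" "\<gamma> t \<in> fst c"
  obtains \<xi> where "((\<lambda>s. snd c (\<gamma> s)) has_vector_derivative \<xi>) (at t within J)"
proof -
  obtain d where d: "d \<in> A" "\<gamma> t \<in> fst d" using manifold_chart[OF M] by blast
  then obtain \<eta> where "((\<lambda>s. snd d (\<gamma> s)) has_vector_derivative \<eta>) (at t within J)"
    using c1_pathD(3)[OF \<gamma> d(1)] t by blast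
  moreover have "continuous (at t within J) \<gamma>"
    using c1_pathD(2)[OF \<gamma>] t by (simp add: continuous_on_eq_continuous_within)
  ultimately show thesis
    using chart_derivative_change[of d c t J \<gamma>] that d t manifoldD[OF M] admissibleD[OF c] by blast
qed

text \<open>Velocities are defined through atlas charts, whereas bundle coordinates are only
  admissible; the change of charts for derivatives bridges the two.\<close>

lemma velocity_eq_tangent_of:
  assumes M: "c1_manifold A" and \<gamma>: "c1_path A J \<gamma>" and c: "admissible_chart A c"
    and t: "t \<in> J" "J \<noteq> {t}" "\<gamma> t \<in> fst c"
    and D: "((\<lambda>s. snd c (\<gamma> s)) has_vector_derivative \<xi>) (at t within J)"
  shows "velocity A J \<gamma> t = tangent_of A c (\<gamma> t) \<xi>"
proof
  fix d
  have "continuous (at t within J) \<gamma>"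
    using c1_pathD(2)[OF \<gamma>] t by (simp add: continuous_on_eq_continuous_within)
  then have "((\<lambda>s. snd d (\<gamma> s)) has_vector_derivative transition c d (\<gamma> t) \<xi>) (at t within J)"
    if "d \<in> A" "\<gamma> t \<in> fst d"
    using chart_derivative_change[of c d t J \<gamma> \<xi>] that t D manifoldD[OF M] admissibleD[OF c] by blast
  moreover have "at t within J \<noteq> bot"
    using at_within_interval_not_bot c1_pathD(1)[OF \<gamma>] t by blast
  ultimately show "velocity A J \<gamma> t d = tangent_of A c (\<gamma> t) \<xi> d"
    by (cases d) (auto simp: velocity_def tangent_of_def vector_derivative_within)
qed

lemma velocity_in_tangent_space:
  assumes M: "c1_manifold A" and \<gamma>: "c1_path A J \<gamma>" and t: "t \<in> J" "J \<noteq> {t}"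
  shows "velocity A J \<gamma> t \<in> tangent_space A (\<gamma> t)"
proof -
  obtain c where c: "c \<in> A" "\<gamma> t \<in> fst c" using manifold_chart[OF M] by blast
  have a: "admissible_chart A c" using admissible_member[OF M c(1)] .
  obtain \<xi> where "((\<lambda>s. snd c (\<gamma> s)) has_vector_derivative \<xi>) (at t within J)"
    using path_chart_derivative[OF M \<gamma> a t(1) c(2)] by blast
  then show ?thesis
    using velocity_eq_tangent_of[OF M \<gamma> a t c(2)] tangent_space_eq_range[OF M a c(2)] by auto
qed

section \<open>Paths prescribed by their coordinates\<close>

lemma continuous_on_matrix_vector_mult:
  fixes M :: "'a::topological_space \<Rightarrow> ('k::real_normed_field)^'n::finite^'m::finite"
  assumes "continuous_on S M" "continuous_on S v"
  shows "continuous_on S (\<lambda>t. M t *v v t)"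
  unfolding matrix_vector_mult_def
  by (intro continuous_on_vec_lambda continuous_on_sum continuous_on_mult continuous_on_component assms)

text \<open>In another chart the derivative is the Jacobian along the path applied to
  \<open>g'\<close>, hence continuous as a product of continuous functions.\<close>

lemma c1_path_from_coordinates:
  fixes g g' :: "real \<Rightarrow> ('k::{real_normed_field,euclidean_space})^'n::finite"
  assumes M: "c1_manifold A" and c: "admissible_chart A c" and J: "is_interval J"
    and g: "\<And>t. t \<in> J \<Longrightarrow> (g has_vector_derivative g' t) (at t within J)"
    and g': "continuous_on J g'" and im: "\<And>t. t \<in> J \<Longrightarrow> g t \<in> snd c ` fst c"
  shows "c1_path A J (\<lambda>t. inv_into (fst c) (snd c) (g t))" (is "c1_path A J ?\<gamma>")
proof (rule c1_pathI[OF J])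
  have cg: "continuous_on J g"
    using g by (meson continuous_on_eq_continuous_within has_vector_derivative_continuous)
  show ct: "continuous_on J ?\<gamma>"
    using continuous_on_compose2[OF chart_inv_continuous[OF admissibleD(1)[OF c]] cg] im by blast
  have in_c: "?\<gamma> t \<in> fst c" and g_eq: "snd c (?\<gamma> t) = g t" if "t \<in> J" for t
    using im[OF that] by (auto simp: inv_into_into f_inv_into_f)
  fix d assume d: "d \<in> A"
  let ?S = "{t \<in> J. ?\<gamma> t \<in> fst d}"
  obtain Jc where Jc: "continuous_on (snd c ` (fst c \<inter> fst d)) Jc"
    and tr: "\<And>x. x \<in> fst c \<Longrightarrow> x \<in> fst d \<Longrightarrow> transition c d x = (\<lambda>v. Jc (snd c x) *v v)"
    using compatible_transition[of c d] admissibleD[OF c] d manifoldD[OF M] by metis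
  have "g ` ?S \<subseteq> snd c ` (fst c \<inter> fst d)"
    using in_c g_eq by (force simp: image_iff)
  then have "continuous_on ?S (\<lambda>t. Jc (g t))"
    by (intro continuous_on_compose2[OF Jc]) (auto intro: continuous_on_subset[OF cg])
  moreover have "continuous_on ?S g'"
    using g' by (rule continuous_on_subset) auto
  ultimately have "continuous_on ?S (\<lambda>t. Jc (g t) *v g' t)"
    by (rule continuous_on_matrix_vector_mult)
  moreover have "((\<lambda>s. snd d (?\<gamma> s)) has_vector_derivative Jc (g t) *v g' t) (at t within J)"
    if t: "t \<in> J" "?\<gamma> t \<in> fst d" for t
  proof -
    have "((\<lambda>s. snd c (?\<gamma> s)) has_vector_derivative g' t) (at t within J)"
      by (rule has_vector_derivative_transform[OF t(1) g_eq g[OF t(1)]])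
    then have "((\<lambda>s. snd d (?\<gamma> s)) has_vector_derivative transition c d (?\<gamma> t) (g' t)) (at t within J)"
      using ct t in_c admissibleD[OF c] d manifoldD[OF M]
      by (intro chart_derivative_change[of c d]) (auto simp: continuous_on_eq_continuous_within)
    then show ?thesis
      using tr[OF in_c[OF t(1)] t(2)] g_eq[OF t(1)] by simp
  qed
  ultimately show "\<exists>g. continuous_on ?S g \<and>
       (\<forall>t\<in>J. ?\<gamma> t \<in> fst d \<longrightarrow> ((\<lambda>s. snd d (?\<gamma> s)) has_vector_derivative g t) (at t within J))"
    by blast
qed

text \<open>A straight segment in coordinates realizes any tangent vector. In the base this
  prescribes the velocity of a path to be transported; in bundle coordinates of the total space, a
  segment whose direction has no base components stays in a fibre.\<close>

lemma line_path:
  fixes A :: "('m::t2_space, 'k::{real_normed_field,euclidean_space}, 'n::finite) chart set"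
  assumes M: "c1_manifold A" and c: "admissible_chart A c" and x: "x \<in> fst c"
  obtains \<gamma> \<epsilon> where "\<epsilon> > 0" "\<gamma> 0 = x" "c1_path A {-\<epsilon><..<\<epsilon>} \<gamma>"
    and "velocity A {-\<epsilon><..<\<epsilon>} \<gamma> 0 = tangent_of A c x \<xi>"
    and "\<forall>t\<in>{-\<epsilon><..<\<epsilon>}. \<gamma> t \<in> fst c \<and> snd c (\<gamma> t) = snd c x + t *\<^sub>R \<xi>"
proof -
  have "open (snd c ` fst c)" using chart_open(2)[OF admissibleD(1)[OF c]] .
  then obtain r where r: "r > 0" "ball (snd c x) r \<subseteq> snd c ` fst c"
    using x by (meson imageI openE)
  \<comment> \<open>The summand \<open>1\<close> keeps the denominator positive when
    \<open>\<xi> = 0\<close>; for \<open>\<bar>t\<bar> < \<epsilon>\<close> the segment stays in the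
    ball of radius \<open>r\<close>.\<close>
  define \<epsilon> where "\<epsilon> = r / (norm \<xi> + 1)"
  have \<epsilon>: "\<epsilon> > 0" using r by (simp add: \<epsilon>_def add_nonneg_pos)
  define g where "g = (\<lambda>t. snd c x + t *\<^sub>R \<xi>)"
  have im: "g t \<in> snd c ` fst c" if "t \<in> {-\<epsilon><..<\<epsilon>}" for t
  proof -
    have "\<bar>t\<bar> * norm \<xi> \<le> \<bar>t\<bar> * (norm \<xi> + 1)" by (simp add: mult_left_mono)
    also have "\<dots> < \<epsilon> * (norm \<xi> + 1)"
      using that by (intro mult_strict_right_mono) (auto simp: add_nonneg_pos)
    also have "\<dots> = r" using norm_ge_zero[of \<xi>] by (simp add: \<epsilon>_def add_nonneg_eq_0_iff)
    finally have "g t \<in> ball (snd c x) r" by (simp add: g_def dist_norm)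
    then show ?thesis using r by blast
  qed
  let ?J = "{-\<epsilon><..<\<epsilon>}"
  define \<gamma> where "\<gamma> = (\<lambda>t. inv_into (fst c) (snd c) (g t))"
  have g: "(g has_vector_derivative \<xi>) (at t within ?J)" for t
    unfolding g_def by (auto intro!: derivative_eq_intros)
  have path: "c1_path A ?J \<gamma>"
    unfolding \<gamma>_def by (rule c1_path_from_coordinates[OF M c _ g _ im]) auto
  have \<gamma>: "\<gamma> t \<in> fst c \<and> snd c (\<gamma> t) = snd c x + t *\<^sub>R \<xi>" if "t \<in> ?J" for t
    using im[OF that] by (auto simp: \<gamma>_def inv_into_into f_inv_into_f g_def)
  have \<gamma>0: "\<gamma> 0 = x"
    using admissibleD(1)[OF c] x by (simp add: \<gamma>_def g_def)
  have "((\<lambda>s. snd c (\<gamma> s)) has_vector_derivative \<xi>) (at 0 within ?J)"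
    using \<epsilon> \<gamma> by (intro has_vector_derivative_transform[OF _ _ g[of 0]]) (simp_all add: g_def)
  moreover have "?J \<noteq> {0}" using \<epsilon> by (auto simp: set_eq_iff intro!: exI[of _ "\<epsilon>/2"])
  ultimately have "velocity A ?J \<gamma> 0 = tangent_of A c x \<xi>"
    using velocity_eq_tangent_of[OF M path c, of 0] \<epsilon> \<gamma>0 x by simp
  then show thesis using that[OF \<epsilon> \<gamma>0 path] \<gamma> by blast
qed

section \<open>Reparametrization, restriction and gluing of paths\<close>

text \<open>The chain rule in every chart. Restriction, reflection and reparametrization of paths
  are all instances.\<close>

lemma c1_path_compose:
  assumes \<gamma>: "c1_path A J \<gamma>" and J': "is_interval J'" and im: "\<theta> ` J' \<subseteq> J" and \<theta>: "c1_real_on J' \<theta>"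
  shows "c1_path A J' (\<lambda>t. \<gamma> (\<theta> t))"
proof (rule c1_pathI[OF J'])
  obtain \<theta>' where \<theta>': "continuous_on J' \<theta>'"
    and D: "\<And>t. t \<in> J' \<Longrightarrow> (\<theta> has_vector_derivative \<theta>' t) (at t within J')"
    using \<theta> by (auto simp: c1_real_on_def has_real_derivative_iff_has_vector_derivative)
  have c\<theta>: "continuous_on J' \<theta>"
    using D by (meson continuous_on_eq_continuous_within has_vector_derivative_continuous)
  show "continuous_on J' (\<lambda>t. \<gamma> (\<theta> t))"
    by (rule continuous_on_compose2[OF c1_pathD(2)[OF \<gamma>] c\<theta> im])
  fix c assume "c \<in> A"
  then obtain g where g: "continuous_on {t\<in>J. \<gamma> t \<in> fst c} g"
    and Dg: "\<And>t. t \<in> J \<Longrightarrow> \<gamma> t \<in> fst c \<Longrightarrow> ((\<lambda>s. snd c (\<gamma> s)) has_vector_derivative g t) (at t within J)"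
    using c1_pathD(3)[OF \<gamma>] by blast
  let ?S = "{t\<in>J'. \<gamma> (\<theta> t) \<in> fst c}"
  have "continuous_on ?S (\<lambda>t. \<theta>' t *\<^sub>R g (\<theta> t))"
    using im by (intro continuous_intros continuous_on_compose2[OF g])
      (auto intro: continuous_on_subset[OF c\<theta>] continuous_on_subset[OF \<theta>'])
  moreover have "((\<lambda>s. snd c (\<gamma> (\<theta> s))) has_vector_derivative \<theta>' t *\<^sub>R g (\<theta> t)) (at t within J')"
    if "t \<in> J'" "\<gamma> (\<theta> t) \<in> fst c" for t
    using vector_diff_chain_within[OF D[OF that(1)], of "\<lambda>s. snd c (\<gamma> s)" "g (\<theta> t)"] im that
      has_vector_derivative_within_subset[OF Dg, of "\<theta> t"] by (auto simp: o_def)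
  ultimately show "\<exists>g. continuous_on ?S g \<and> (\<forall>t\<in>J'. \<gamma> (\<theta> t) \<in> fst c \<longrightarrow>
      ((\<lambda>s. snd c (\<gamma> (\<theta> s))) has_vector_derivative g t) (at t within J'))"
    by blast
qed

text \<open>The rate \<open>k\<close> is real and acts on tangent vectors through its image in the
  ground field. The case \<open>k = 1\<close> compares velocities on nested intervals, one-sided
  ones included, and \<open>k = -1\<close> treats reflected paths.\<close>

lemma velocity_compose:
  assumes M: "c1_manifold A" and \<gamma>: "c1_path A J \<gamma>" and J': "is_interval J'" and im: "\<theta> ` J' \<subseteq> J"
    and t: "t \<in> J'" "J' \<noteq> {t}" "J \<noteq> {\<theta> t}" and \<theta>: "(\<theta> has_real_derivative k) (at t within J')"
  shows "velocity A J' (\<lambda>t. \<gamma> (\<theta> t)) t = tscale (of_real k) (velocity A J \<gamma> (\<theta> t))"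
proof
  fix c
  have nb: "at t within J' \<noteq> bot" "at (\<theta> t) within J \<noteq> bot"
    using at_within_interval_not_bot c1_pathD(1)[OF \<gamma>] t J' im by blast+
  show "velocity A J' (\<lambda>t. \<gamma> (\<theta> t)) t c = tscale (of_real k) (velocity A J \<gamma> (\<theta> t)) c"
  proof (cases "c \<in> A \<and> \<gamma> (\<theta> t) \<in> fst c")
    case True
    then obtain \<xi> where D: "((\<lambda>s. snd c (\<gamma> s)) has_vector_derivative \<xi>) (at (\<theta> t) within J)"
      using c1_pathD(3)[OF \<gamma>] t im by blast
    have "((\<lambda>s. snd c (\<gamma> (\<theta> s))) has_vector_derivative k *\<^sub>R \<xi>) (at t within J')"
      using vector_diff_chain_within[of \<theta> k t J' "\<lambda>s. snd c (\<gamma> s)" \<xi>] \<theta>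
        has_vector_derivative_within_subset[OF D im]
      by (auto simp: o_def has_real_derivative_iff_has_vector_derivative)
    moreover have "k *\<^sub>R \<xi> = of_real k *s \<xi>"
      by (simp add: vec_eq_iff) (simp add: scaleR_conv_of_real)
    ultimately show ?thesis
      using True D nb by (cases c) (simp add: velocity_def tscale_def vector_derivative_within)
  qed (cases c; auto simp: velocity_def tscale_def)
qed

lemma c1_real_on_affine: "c1_real_on S (\<lambda>t. a + b * t)"
  unfolding c1_real_on_def by (rule exI[of _ "\<lambda>_. b"]) (auto intro!: derivative_eq_intros)

lemma c1_path_subset:
  assumes "c1_path A J \<gamma>" "is_interval J'" "J' \<subseteq> J"
  shows "c1_path A J' \<gamma>"
  \<comment> \<open>The inclusion of \<open>J'\<close> is written as an affine map so that
    \<open>c1_real_on_affine\<close> applies.\<close>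
  using c1_path_compose[OF assms(1,2), of "\<lambda>t. 0 + 1 * t"] assms(3) c1_real_on_affine[of J' 0 1] by auto

lemma velocity_subset:
  assumes "c1_manifold A" "c1_path A J \<gamma>" "is_interval J'" "J' \<subseteq> J" "t \<in> J'" "J' \<noteq> {t}"
  shows "velocity A J' \<gamma> t = velocity A J \<gamma> t"
  using velocity_compose[OF assms(1-3), of "\<lambda>t. t" t 1] assms(4-6) by (auto simp: tscale_def)

lemma c1_path_const: "c1_path A J (\<lambda>_. x)" if "is_interval J"
  using that by (intro c1_pathI) (auto intro!: exI[of _ "\<lambda>_. 0"])

lemma c1_path_uminus:
  "c1_path A (uminus ` J) (\<lambda>t. \<gamma> (- t))" if "c1_path A J \<gamma>"
proof -
  have "is_interval (uminus ` J)"
    using c1_pathD(1)[OF that] by simp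
  then show ?thesis
    using c1_path_compose[OF that, of "uminus ` J" "\<lambda>t. 0 + (-1) * t"] c1_real_on_affine[of "uminus ` J" 0 "-1"]
    by (auto simp: image_image)
qed

lemma c1_path_cong:
  assumes "c1_path A J \<gamma>" and eq: "\<And>t. t \<in> J \<Longrightarrow> \<gamma>' t = \<gamma> t"
  shows "c1_path A J \<gamma>'"
proof (rule c1_pathI)
  show "is_interval J" "continuous_on J \<gamma>'"
    using c1_pathD(1,2)[OF assms(1)] eq by (auto cong: continuous_on_cong)
  fix c assume "c \<in> A"
  then obtain g where g: "continuous_on {t\<in>J. \<gamma> t \<in> fst c} g"
    and D: "\<And>t. t \<in> J \<Longrightarrow> \<gamma> t \<in> fst c \<Longrightarrow> ((\<lambda>s. snd c (\<gamma> s)) has_vector_derivative g t) (at t within J)"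
    using c1_pathD(3)[OF assms(1)] by blast
  have S: "{t\<in>J. \<gamma>' t \<in> fst c} = {t\<in>J. \<gamma> t \<in> fst c}"
    using eq by auto
  have "((\<lambda>s. snd c (\<gamma>' s)) has_vector_derivative g t) (at t within J)" if "t \<in> J" "\<gamma>' t \<in> fst c" for t
    using that eq by (intro has_vector_derivative_transform[OF _ _ D]) simp_all
  then show "\<exists>g. continuous_on {t\<in>J. \<gamma>' t \<in> fst c} g \<and> (\<forall>t\<in>J. \<gamma>' t \<in> fst c \<longrightarrow>
      ((\<lambda>s. snd c (\<gamma>' s)) has_vector_derivative g t) (at t within J))"
    unfolding S using g by blast
qed

lemma velocity_cong:
  assumes "c1_manifold A" "c1_path A J \<gamma>" "\<And>t. t \<in> J \<Longrightarrow> \<gamma>' t = \<gamma> t" "t \<in> J" "J \<noteq> {t}"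
  shows "velocity A J \<gamma>' t = velocity A J \<gamma> t"
proof -
  have path: "c1_path A J \<gamma>'" using c1_path_cong[OF assms(2,3)] .
  obtain c where c: "c \<in> A" "\<gamma> t \<in> fst c" using manifold_chart[OF assms(1)] by blast
  obtain \<xi> where \<xi>: "((\<lambda>s. snd c (\<gamma> s)) has_vector_derivative \<xi>) (at t within J)"
    using c1_pathD(3)[OF assms(2) c(1)] c assms(4) by blast
  have "((\<lambda>s. snd c (\<gamma>' s)) has_vector_derivative \<xi>) (at t within J)"
    using assms(3) by (intro has_vector_derivative_transform[OF assms(4) _ \<xi>]) simp
  then show ?thesis
    using velocity_eq_tangent_of[OF assms(1) _ admissible_member[OF assms(1) c(1)] assms(4,5)] \<xi> c assms(2,3,4) path
    by metis
qed

text \<open>Each \<open>K\<close> contains a neighbourhood of \<open>t\<close> relative to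
  \<open>J\<close>, so limits and derivatives within \<open>J\<close> and within \<open>K\<close>
  agree near \<open>t\<close>. This serves for lifts that are known to be smooth only on compact
  subintervals.\<close>

lemma c1_path_local:
  assumes J: "is_interval J"
    and loc: "\<And>t. t \<in> J \<Longrightarrow> \<exists>K e. t \<in> K \<and> K \<subseteq> J \<and> c1_path A K \<gamma> \<and> e > 0 \<and> J \<inter> ball t e \<subseteq> K"
  shows "c1_path A J \<gamma>"
proof (rule c1_pathI[OF J])
  have win: "at s within J = at s within K" if "K \<subseteq> J" "J \<inter> ball t e \<subseteq> K" "s \<in> ball t e" for s t e K
    by (rule at_within_nhd[of _ "ball t e"]) (use that in auto)
  show "continuous_on J \<gamma>"
    unfolding continuous_on_eq_continuous_within
  proof
    fix t assume "t \<in> J"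
    then obtain K e where K: "t \<in> K" "K \<subseteq> J" "c1_path A K \<gamma>" "e > 0" "J \<inter> ball t e \<subseteq> K"
      using loc[OF \<open>t \<in> J\<close>] by (elim exE conjE)
    show "continuous (at t within J) \<gamma>"
      using c1_pathD(2)[OF K(3)] K win[OF K(2,5), of t] by (auto simp: continuous_on_eq_continuous_within)
  qed
  fix c assume c: "c \<in> A"
  let ?S = "{t \<in> J. \<gamma> t \<in> fst c}"
  show "\<exists>g. continuous_on ?S g \<and> (\<forall>t\<in>J. \<gamma> t \<in> fst c \<longrightarrow>
      ((\<lambda>s. snd c (\<gamma> s)) has_vector_derivative g t) (at t within J))"
  \<comment> \<open>On a one-point interval every vector is a derivative, so
    \<open>vector_derivative\<close> is of no use; but there \<open>K = J\<close>.\<close>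
  proof (cases "\<exists>t. J = {t}")
    case True
    then obtain t where t: "J = {t}" by blast
    then obtain K where "t \<in> K" "K \<subseteq> J" "c1_path A K \<gamma>" using loc[of t] by auto
    moreover from this t have "K = J" by blast
    ultimately show ?thesis using c1_pathD(3) c by blast
  next
    case False
    \<comment> \<open>The derivatives \<open>h\<close> found below depend on \<open>K\<close>. The
      derivative within \<open>J\<close> is a single function that equals each \<open>h\<close> near
      the point in question.\<close>
    define g where "g = (\<lambda>t. vector_derivative (\<lambda>s. snd c (\<gamma> s)) (at t within J))"
    have nb: "at t within J \<noteq> bot" if "t \<in> J" for t
      using at_within_interval_not_bot[OF J that] False by blast
    have *: "((\<lambda>s. snd c (\<gamma> s)) has_vector_derivative g t) (at t within J) \<and> continuous (at t within ?S) g"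
      if t: "t \<in> ?S" for t
    proof -
      obtain K e where K: "t \<in> K" "K \<subseteq> J" "c1_path A K \<gamma>" "e > 0" "J \<inter> ball t e \<subseteq> K"
        using loc[of t] t by (auto elim!: exE conjE)
      obtain h where h: "continuous_on {t\<in>K. \<gamma> t \<in> fst c} h"
        and D: "\<And>t. t \<in> K \<Longrightarrow> \<gamma> t \<in> fst c \<Longrightarrow> ((\<lambda>s. snd c (\<gamma> s)) has_vector_derivative h t) (at t within K)"
        using c1_pathD(3)[OF K(3) c] by blast
      have DJ: "((\<lambda>s. snd c (\<gamma> s)) has_vector_derivative h s) (at s within J) \<and> g s = h s"
        if "s \<in> ?S" "s \<in> ball t e" for s
      proof -
        have "((\<lambda>s. snd c (\<gamma> s)) has_vector_derivative h s) (at s within J)"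
          using win[OF K(2,5) that(2)] D[of s] that K by auto
        then show ?thesis
          unfolding g_def using nb[of s] that by (auto intro: vector_derivative_within)
      qed
      have "continuous (at t within {t\<in>K. \<gamma> t \<in> fst c}) h"
        using h t K by (auto simp: continuous_on_eq_continuous_within)
      moreover have "at t within {t\<in>K. \<gamma> t \<in> fst c} = at t within ?S"
        by (rule at_within_nhd[of _ "ball t e"]) (use K in auto)
      ultimately have "continuous (at t within ?S) h" by simp
      then have "continuous (at t within ?S) g"
        by (rule continuous_transform_within[where \<delta> = e]) (use K DJ t in \<open>auto simp: dist_commute\<close>)
      then show ?thesis using DJ[of t] t K by simp
    qed
    then show ?thesis
      by (intro exI[of _ g]) (auto simp: continuous_on_eq_continuous_within)
  qed
qed

section \<open>Elementary properties of parallel transports\<close>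

text \<open>A positive derivative makes the map strictly increasing, the intermediate value theorem
  makes it onto, and the inverse has the continuous derivative \<open>1 / \<theta>'\<close>, taken
  at the preimage.\<close>

lemma orientation_preserving_diffeoI:
  fixes \<theta> \<theta>' :: "real \<Rightarrow> real"
  assumes ab: "a \<le> b" and D: "\<And>u. u \<in> {a..b} \<Longrightarrow> (\<theta> has_real_derivative \<theta>' u) (at u)"
    and pos: "\<And>u. u \<in> {a..b} \<Longrightarrow> 0 < \<theta>' u" and cont: "continuous_on {a..b} \<theta>'"
  shows "orientation_preserving_diffeo a b (\<theta> a) (\<theta> b) \<theta>"
proof -
  have mono: "\<theta> u < \<theta> v" if "u < v" "u \<in> {a..b}" "v \<in> {a..b}" for u v
    using that by (intro DERIV_pos_imp_increasing[OF that(1)]) (meson D pos atLeastAtMost_iff order_trans)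
  have c: "continuous_on {a..b} \<theta>"
    using D by (meson DERIV_isCont continuous_at_imp_continuous_on)
  have inj: "inj_on \<theta> {a..b}"
    by (rule linorder_inj_onI) (use mono in force)+
  have "\<theta> u \<in> {\<theta> a..\<theta> b}" if "u \<in> {a..b}" for u
    using mono[of a u] mono[of u b] that ab by (cases "u = a"; cases "u = b"; force)
  moreover have "v \<in> \<theta> ` {a..b}" if "v \<in> {\<theta> a..\<theta> b}" for v
    using IVT'[of \<theta> a v b] that ab c by force
  ultimately have im: "\<theta> ` {a..b} = {\<theta> a..\<theta> b}" by blast
  define \<eta> where "\<eta> = inv_into {a..b} \<theta>"
  have \<eta>\<theta>: "\<eta> (\<theta> u) = u" if "u \<in> {a..b}" for u
    using inj that by (simp add: \<eta>_def)
  have \<eta>: "\<eta> v \<in> {a..b}" "\<theta> (\<eta> v) = v" if "v \<in> {\<theta> a..\<theta> b}" for v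
    using that im by (auto simp: \<eta>_def intro!: inv_into_into f_inv_into_f simp del: atLeastAtMost_iff)
  \<comment> \<open>The inverse of a continuous injection on a compact set is continuous, which the
    inverse rule for derivatives requires.\<close>
  have c\<eta>: "continuous_on {\<theta> a..\<theta> b} \<eta>"
    using continuous_on_inv[OF c, of \<eta>] \<eta>\<theta> im by auto
  have "(\<eta> has_real_derivative inverse (\<theta>' (\<eta> v))) (at v within {\<theta> a..\<theta> b})"
    if v: "v \<in> {\<theta> a..\<theta> b}" for v
  proof -
    have "\<theta>' (\<eta> v) \<noteq> 0" using pos[OF \<eta>(1)[OF v]] by simp
    moreover have "(\<theta> has_derivative (*) (\<theta>' (\<eta> v))) (at (\<eta> v) within {a..b})"
      using D[OF \<eta>(1)[OF v]] by (simp add: has_field_derivative_def has_derivative_at_withinI)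
    ultimately have "(\<eta> has_derivative (*) (inverse (\<theta>' (\<eta> v)))) (at (\<theta> (\<eta> v)) within \<theta> ` {a..b})"
      using c\<eta> v \<eta>[OF v] \<eta>\<theta> im
      by (intro has_derivative_inverse_within[where f' = "(*) (\<theta>' (\<eta> v))"])
        (auto simp: fun_eq_iff linear_times continuous_on_eq_continuous_within)
    then show ?thesis
      using \<eta>(2)[OF v] im by (simp add: has_field_derivative_def)
  qed
  moreover have "continuous_on {\<theta> a..\<theta> b} (\<lambda>v. inverse (\<theta>' (\<eta> v)))"
    using pos \<eta>(1) by (intro continuous_on_inverse continuous_on_compose2[OF cont c\<eta>])
      (auto simp del: atLeastAtMost_iff dest!: \<eta>(1) pos)
  ultimately have "c1_real_on {\<theta> a..\<theta> b} \<eta>"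
    unfolding c1_real_on_def by blast
  moreover have "c1_real_on {a..b} \<theta>"
    unfolding c1_real_on_def using cont D by (meson has_field_derivative_at_within)
  moreover have "strict_mono_on {a..b} \<theta>"
    using mono by (simp add: strict_mono_on_def)
  moreover have "bij_betw \<theta> {a..b} {\<theta> a..\<theta> b}"
    using inj im by (simp add: bij_betw_def)
  ultimately show ?thesis
    by (simp add: orientation_preserving_diffeo_def \<eta>_def)
qed

text \<open>
  The product axiom is available only when the product path is again $C^1$, so a path on
  \<open>{\<sigma>..t}\<close> cannot be cut at \<open>s\<close> by affine reparametrizations of the two pieces.  The fractional
  linear map taking \<open>0\<close>, \<open>1/2\<close>, \<open>1\<close> to \<open>\<sigma>\<close>, \<open>s\<close>, \<open>t\<close> is smooth across the cut.
\<close>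

lemma three_point_reparametrization:
  fixes \<sigma> s t :: real
  assumes "\<sigma> < s" "s < t"
  obtains \<theta> \<theta>' where "\<theta> 0 = \<sigma>" "\<theta> (1/2) = s" "\<theta> 1 = t"
    and "\<And>u. u \<in> {0..1} \<Longrightarrow> (\<theta> has_real_derivative \<theta>' u) (at u) \<and> 0 < \<theta>' u"
    and "continuous_on {0..1} \<theta>'"
proof -
  define A B where "A = s - \<sigma>" and "B = t - s"
  have AB: "A > 0" "B > 0" using assms by (auto simp: A_def B_def)
  \<comment> \<open>With these weights the fraction is \<open>A\<close> at \<open>1/2\<close> and
    \<open>A + B\<close> at \<open>1\<close>. The denominator is a convex combination of
    \<open>A\<close> and \<open>B\<close>, and the numerator of the derivative is the constant
    \<open>(A + B) * A * B\<close>.\<close>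
  define \<theta> \<theta>' where "\<theta> = (\<lambda>u. \<sigma> + (A + B) * A * u / (A * u + B * (1 - u)))"
    and "\<theta>' = (\<lambda>u. (A + B) * A * B / (A * u + B * (1 - u))\<^sup>2)"
  have den: "A * u + B * (1 - u) > 0" if "u \<in> {0..1}" for u
  proof (cases "u = 0")
    case False
    then have "A * u > 0" "B * (1 - u) \<ge> 0" using that AB by auto
    then show ?thesis by linarith
  qed (use AB in auto)
  have "(\<theta> has_real_derivative \<theta>' u) (at u) \<and> 0 < \<theta>' u" if "u \<in> {0..1}" for u
  proof
    show "0 < \<theta>' u" using den[OF that] AB by (simp add: \<theta>'_def)
    have "A * u + B * (1 - u) \<noteq> 0" using den[OF that] by simp
    then show "(\<theta> has_real_derivative \<theta>' u) (at u)"
      unfolding \<theta>_def \<theta>'_def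
      by (auto intro!: derivative_eq_intros simp: power2_eq_square field_simps)
  qed
  moreover have "continuous_on {0..1} \<theta>'"
    unfolding \<theta>'_def using den by (intro continuous_intros) force
  moreover have "\<theta> 0 = \<sigma>" "\<theta> (1/2) = s" "\<theta> 1 = t"
    using AB by (auto simp: \<theta>_def A_def B_def field_simps)
  ultimately show thesis using that by blast
qed

section \<open>Transport along constant, subdivided and reversed paths\<close>

context parallel_transport
begin

text \<open>On a one-point interval every path agrees with a constant one, so axiom (iv)
  applies.\<close>

lemma transport_trivial:
  assumes "pr p = \<gamma> t"
  shows "P t t \<gamma> p = p"
proof -
  have "P t t \<gamma> p = P t t (\<lambda>_. \<gamma> t) p"
    using assms by (intro transport_cong c1_path_const is_interval_cc) auto
  then show ?thesis using transport_point assms by simp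
qed

lemma transport_increasing_reparam:
  assumes "a < b" and D: "\<And>u. u \<in> {a..b} \<Longrightarrow> (\<theta> has_real_derivative \<theta>' u) (at u) \<and> 0 < \<theta>' u"
    and cont: "continuous_on {a..b} \<theta>'" and \<gamma>: "c1_path \<A>\<^sub>M {\<theta> a..\<theta> b} \<gamma>" and p: "pr p = \<gamma> (\<theta> a)"
  shows "P a b (\<lambda>u. \<gamma> (\<theta> u)) p = P (\<theta> a) (\<theta> b) \<gamma> p" and "c1_path \<A>\<^sub>M {a..b} (\<lambda>u. \<gamma> (\<theta> u))"
proof -
  have d: "orientation_preserving_diffeo a b (\<theta> a) (\<theta> b) \<theta>"
    using assms by (intro orientation_preserving_diffeoI) auto
  have "\<theta> a < \<theta> b"
    using assms(1) by (rule DERIV_pos_imp_increasing) (use D in force)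
  then show "P a b (\<lambda>u. \<gamma> (\<theta> u)) p = P (\<theta> a) (\<theta> b) \<gamma> p"
    using transport_reparam[OF _ _ \<gamma> d p] assms(1) by (simp add: o_def)
  show "c1_path \<A>\<^sub>M {a..b} (\<lambda>u. \<gamma> (\<theta> u))"
    using d by (intro c1_path_compose[OF \<gamma>])
      (auto simp: orientation_preserving_diffeo_def bij_betw_def is_interval_cc)
qed

text \<open>Axioms (ii) and (iii) are stated for paths on \<open>{0..1}\<close> only; this moves any
  nondegenerate interval there.\<close>

lemma transport_affine:
  assumes "\<sigma> < \<tau>" and \<gamma>: "c1_path \<A>\<^sub>M {\<sigma>..\<tau>} \<gamma>" and p: "pr p = \<gamma> \<sigma>"
  shows "P 0 1 (\<lambda>u. \<gamma> (\<sigma> + (\<tau> - \<sigma>) * u)) p = P \<sigma> \<tau> \<gamma> p"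
    and "c1_path \<A>\<^sub>M {0..1} (\<lambda>u. \<gamma> (\<sigma> + (\<tau> - \<sigma>) * u))"
proof -
  have "((\<lambda>u. \<sigma> + (\<tau> - \<sigma>) * u) has_real_derivative \<tau> - \<sigma>) (at u)" for u
    by (auto intro!: derivative_eq_intros)
  then show "P 0 1 (\<lambda>u. \<gamma> (\<sigma> + (\<tau> - \<sigma>) * u)) p = P \<sigma> \<tau> \<gamma> p"
    "c1_path \<A>\<^sub>M {0..1} (\<lambda>u. \<gamma> (\<sigma> + (\<tau> - \<sigma>) * u))"
    using transport_increasing_reparam[of 0 1 "\<lambda>u. \<sigma> + (\<tau> - \<sigma>) * u" "\<lambda>_. \<tau> - \<sigma>" \<gamma> p] assms
    by simp_all
qed

text \<open>Axiom (iv) covers one-point intervals only. On \<open>{0..1}\<close> a constant path is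
  its own inverse and its own product with itself, so (iii) and (ii) give
  \<open>?Q p = ?Q (?Q p) = p\<close>.\<close>

lemma transport_const:
  assumes "\<sigma> \<le> \<tau>" "pr p = x"
  shows "P \<sigma> \<tau> (\<lambda>_. x) p = p"
proof (cases "\<sigma> < \<tau>")
  case True
  have path: "c1_path \<A>\<^sub>M J (\<lambda>_. x)" if "is_interval J" for J
    by (rule c1_path_const[OF that])
  let ?Q = "P 0 1 (\<lambda>_. x)"
  have "?Q p = ?Q (?Q p)"
    using transport_product[of "\<lambda>_. x" "\<lambda>_. x" p] path assms(2)
    by (simp add: joinpaths_def is_interval_cc)
  also have "\<dots> = p"
    using transport_inverse[of "\<lambda>_. x"] path assms(2) by (simp add: reversepath_def is_interval_cc)
  finally show ?thesis
    using transport_affine(1)[OF True path, of p] assms by (simp add: is_interval_cc)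
qed (use assms transport_point in auto)

text \<open>Turns axiom (iii), on products of paths over \<open>{0..1}\<close>, into a rule for
  cutting one path at an interior point.\<close>

lemma transport_comp:
  assumes st: "\<sigma> \<le> s" "s \<le> t" and \<gamma>: "c1_path \<A>\<^sub>M {\<sigma>..t} \<gamma>" and p: "pr p = \<gamma> \<sigma>"
  shows "P s t \<gamma> (P \<sigma> s \<gamma> p) = P \<sigma> t \<gamma> p"
proof -
  have path: "c1_path \<A>\<^sub>M {a..b} \<gamma>" if "\<sigma> \<le> a" "b \<le> t" for a b
    using that by (intro c1_path_subset[OF \<gamma>]) (auto simp: is_interval_cc)
  have pr_s: "pr (P \<sigma> s \<gamma> p) = \<gamma> s"
    using st p path by (intro transport_fibre) auto
  consider "\<sigma> = s" | "s = t" | "\<sigma> < s" "s < t" using st by linarith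
  then show ?thesis
  proof cases
    case 1
    then show ?thesis using transport_trivial p by simp
  next
    case 2
    then show ?thesis using transport_trivial[of _ \<gamma> s] pr_s by simp
  next
    case 3
    then obtain \<theta> \<theta>' where \<theta>: "\<theta> 0 = \<sigma>" "\<theta> (1/2) = s" "\<theta> 1 = t"
      and D: "\<And>u. u \<in> {0..1} \<Longrightarrow> (\<theta> has_real_derivative \<theta>' u) (at u) \<and> 0 < \<theta>' u"
      and cont: "continuous_on {0..1} \<theta>'"
      using three_point_reparametrization by blast
    \<comment> \<open>\<open>m = 0\<close> gives the piece of the path before \<open>s\<close>, and
      \<open>m = 1/2\<close> the piece after it.\<close>
    have half: "P 0 1 (\<lambda>u. \<gamma> (\<theta> (m + 1/2 * u))) q = P (\<theta> m) (\<theta> (m + 1/2)) \<gamma> q"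
      "c1_path \<A>\<^sub>M {0..1} (\<lambda>u. \<gamma> (\<theta> (m + 1/2 * u)))"
      if "m \<in> {0..1/2}" "c1_path \<A>\<^sub>M {\<theta> m..\<theta> (m + 1/2)} \<gamma>" "pr q = \<gamma> (\<theta> m)" for m q
    proof -
      have "((\<lambda>u. \<theta> (m + 1/2 * u)) has_real_derivative \<theta>' (m + 1/2 * u) * (1/2)) (at u)"
        if "u \<in> {0..1}" for u
        using that \<open>m \<in> {0..1/2}\<close>
        by (intro DERIV_chain2[where f = \<theta>]) (auto intro!: D[THEN conjunct1] derivative_eq_intros)
      moreover have "0 < \<theta>' (m + 1/2 * u) * (1/2)" if "u \<in> {0..1}" for u
        using that \<open>m \<in> {0..1/2}\<close> D by simp
      moreover have "continuous_on {0..1} (\<lambda>u. \<theta>' (m + 1/2 * u) * (1/2))"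
        using \<open>m \<in> {0..1/2}\<close> by (intro continuous_intros continuous_on_compose2[OF cont]) auto
      ultimately show "P 0 1 (\<lambda>u. \<gamma> (\<theta> (m + 1/2 * u))) q = P (\<theta> m) (\<theta> (m + 1/2)) \<gamma> q"
        "c1_path \<A>\<^sub>M {0..1} (\<lambda>u. \<gamma> (\<theta> (m + 1/2 * u)))"
        using transport_increasing_reparam[of 0 1 "\<lambda>u. \<theta> (m + 1/2 * u)" "\<lambda>u. \<theta>' (m + 1/2 * u) * (1/2)" \<gamma> q] that
        by auto
    qed
    let ?\<gamma>1 = "\<lambda>u. \<gamma> (\<theta> (0 + 1/2 * u))" and ?\<gamma>2 = "\<lambda>u. \<gamma> (\<theta> (1/2 + 1/2 * u))"
    have 1: "P 0 1 ?\<gamma>1 p = P \<sigma> s \<gamma> p" "c1_path \<A>\<^sub>M {0..1} ?\<gamma>1"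
      using half[of 0 p] \<theta> p path st by auto
    have 2: "P 0 1 ?\<gamma>2 (P \<sigma> s \<gamma> p) = P s t \<gamma> (P \<sigma> s \<gamma> p)" "c1_path \<A>\<^sub>M {0..1} ?\<gamma>2"
      using half[of "1/2" "P \<sigma> s \<gamma> p"] \<theta> pr_s path st by auto
    have 3: "P 0 1 (\<lambda>u. \<gamma> (\<theta> u)) p = P \<sigma> t \<gamma> p" "c1_path \<A>\<^sub>M {0..1} (\<lambda>u. \<gamma> (\<theta> u))"
      using transport_increasing_reparam[of 0 1 \<theta> \<theta>' \<gamma> p] D cont \<theta> p \<gamma> by auto
    \<comment> \<open>The halving of the parameter cancels against the doubling in the product. The
      product is thus the whole path reparametrized by \<open>\<theta>\<close>, which is again $C^1$
      as axiom (iii) demands.\<close>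
    have join: "?\<gamma>1 +++ ?\<gamma>2 = (\<lambda>u. \<gamma> (\<theta> u))"
      by (auto simp: joinpaths_def fun_eq_iff diff_divide_distrib)
    have "P 0 1 (?\<gamma>1 +++ ?\<gamma>2) p = P 0 1 ?\<gamma>2 (P 0 1 ?\<gamma>1 p)"
    proof (rule transport_product[OF 1(2) 2(2)])
      show "c1_path \<A>\<^sub>M {0..1} (?\<gamma>1 +++ ?\<gamma>2)" unfolding join by (rule 3(2))
    qed (simp_all add: \<theta> p)
    then show ?thesis unfolding join 1(1) 2(1) 3(1) by (rule sym)
  qed
qed

text \<open>Axiom (ii) for arbitrary intervals. Reflecting the parameter at \<open>0\<close>
  reverses a path uniformly for all intervals, so restrictions of the reversed path are reversals of
  restrictions.\<close>

lemma transport_uminus: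
  assumes "\<sigma> \<le> \<tau>" and \<gamma>: "c1_path \<A>\<^sub>M {\<sigma>..\<tau>} \<gamma>" and p: "pr p = \<gamma> \<sigma>"
  shows "P (- \<tau>) (- \<sigma>) (\<lambda>u. \<gamma> (- u)) (P \<sigma> \<tau> \<gamma> p) = p"
proof (cases "\<sigma> < \<tau>")
  case True
  let ?\<delta> = "\<lambda>u. \<gamma> (\<sigma> + (\<tau> - \<sigma>) * u)"
  have q: "pr (P \<sigma> \<tau> \<gamma> p) = \<gamma> \<tau>" using assms by (intro transport_fibre)
  have \<gamma>m: "c1_path \<A>\<^sub>M {- \<tau>..- \<sigma>} (\<lambda>u. \<gamma> (- u))" using c1_path_uminus[OF \<gamma>] by simp
  have "P 0 1 (reversepath ?\<delta>) (P 0 1 ?\<delta> p) = p"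
    using transport_inverse[OF transport_affine(2)[OF True \<gamma> p]] p by simp
  \<comment> \<open>The reversal of the path moved to \<open>{0..1}\<close> is the reflected path
    moved to \<open>{0..1}\<close>.\<close>
  moreover have "reversepath ?\<delta> = (\<lambda>u. \<gamma> (- (- \<tau> + (- \<sigma> - - \<tau>) * u)))"
    by (simp add: reversepath_def algebra_simps)
  ultimately show ?thesis
    using transport_affine(1)[OF True \<gamma> p] transport_affine(1)[OF _ \<gamma>m, of "P \<sigma> \<tau> \<gamma> p"] True q by simp
qed (use assms transport_trivial[of _ \<gamma>] transport_trivial[of _ "\<lambda>u. \<gamma> (- u)"] in auto)

text \<open>The transport to \<open>\<tau>\<close> factors through the parameter \<open>- u\<close>,
  and the reversed path undoes exactly the last factor. So the lift of the reversed path runs back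
  along the original lift.\<close>

lemma transport_lift_uminus:
  assumes \<gamma>: "c1_path \<A>\<^sub>M {\<sigma>..\<tau>} \<gamma>" and p: "pr p = \<gamma> \<sigma>" and u: "u \<in> {- \<tau>..- \<sigma>}"
  shows "transport_lift P (- \<tau>) (\<lambda>u. \<gamma> (- u)) (P \<sigma> \<tau> \<gamma> p) u = transport_lift P \<sigma> \<gamma> p (- u)"
proof -
  have sub: "c1_path \<A>\<^sub>M {a..b} \<gamma>" if "\<sigma> \<le> a" "b \<le> \<tau>" for a b
    using that by (intro c1_path_subset[OF \<gamma>]) (auto simp: is_interval_cc)
  have "P \<sigma> \<tau> \<gamma> p = P (- u) \<tau> \<gamma> (P \<sigma> (- u) \<gamma> p)"
    using u by (intro transport_comp[symmetric] \<gamma> p) auto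
  moreover have "pr (P \<sigma> (- u) \<gamma> p) = \<gamma> (- u)"
    using u p sub by (intro transport_fibre) auto
  ultimately show ?thesis
    using transport_uminus[of "- u" \<tau> \<gamma> "P \<sigma> (- u) \<gamma> p"] u sub by (simp add: transport_lift_def)
qed

end

section \<open>Bundle coordinates\<close>

context c1_bundle
begin

definition bundle_charts :: "('m,'k,'n) chart \<Rightarrow> ('e,'k,'n + 'r) chart \<Rightarrow> bool"
  where "bundle_charts c d \<longleftrightarrow> admissible_chart \<A>\<^sub>M c \<and> admissible_chart \<A>\<^sub>E d \<and> pr ` fst d \<subseteq> fst c \<and>
    (\<forall>q\<in>fst d. \<forall>i. snd d q $ Inl i = snd c (pr q) $ i)"

lemma bundle_chartsD:
  assumes "bundle_charts c d"
  shows "admissible_chart \<A>\<^sub>M c" "admissible_chart \<A>\<^sub>E d"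
    and "q \<in> fst d \<Longrightarrow> pr q \<in> fst c" and "q \<in> fst d \<Longrightarrow> snd d q $ Inl i = snd c (pr q) $ i"
  using assms unfolding bundle_charts_def by auto

lemma bundle_charts_exist:
  obtains c d where "bundle_charts c d" "p \<in> fst d" "pr p \<in> fst c"
proof -
  obtain U \<phi> V \<psi> where "admissible_chart \<A>\<^sub>M (U,\<phi>)" "admissible_chart \<A>\<^sub>E (V,\<psi>)"
      "p \<in> V" "pr ` V \<subseteq> U" "\<forall>q\<in>V. \<forall>i. \<psi> q $ Inl i = \<phi> (pr q) $ i"
    using bundle_coordinates[of p] by blast
  then have "bundle_charts (U,\<phi>) (V,\<psi>)" "p \<in> fst (V,\<psi>)" "pr p \<in> fst (U,\<phi>)"
    by (auto simp: bundle_charts_def)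
  then show thesis by (rule that)
qed

text \<open>In bundle coordinates the differential of \<open>pr\<close> forgets all but the
  \<open>Inl\<close> components. This follows by differentiating the coordinate identity, which
  holds as long as \<open>\<beta>\<close> stays in the domain of \<open>d\<close>, hence near
  \<open>t\<close>.\<close>

lemma lift_velocity_coordinates:
  assumes cd: "bundle_charts c d" and \<beta>: "c1_path \<A>\<^sub>E J \<beta>" and \<gamma>: "c1_path \<A>\<^sub>M J \<gamma>"
    and pr: "\<And>s. s \<in> J \<Longrightarrow> pr (\<beta> s) = \<gamma> s" and t: "t \<in> J" "J \<noteq> {t}" "\<beta> t \<in> fst d"
  obtains \<xi> \<eta> where "velocity \<A>\<^sub>E J \<beta> t = tangent_of \<A>\<^sub>E d (\<beta> t) \<eta>"
    and "velocity \<A>\<^sub>M J \<gamma> t = tangent_of \<A>\<^sub>M c (\<gamma> t) \<xi>" and "\<And>i. \<eta> $ Inl i = \<xi> $ i"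
proof -
  have c: "admissible_chart \<A>\<^sub>M c" and d: "admissible_chart \<A>\<^sub>E d"
    using bundle_chartsD[OF cd] by simp_all
  have \<gamma>t: "\<gamma> t \<in> fst c" using bundle_chartsD(3)[OF cd t(3)] pr[OF t(1)] by simp
  obtain \<eta> where \<eta>: "((\<lambda>s. snd d (\<beta> s)) has_vector_derivative \<eta>) (at t within J)"
    using path_chart_derivative[OF manifold_total \<beta> d t(1) t(3)] .
  obtain \<xi> where \<xi>: "((\<lambda>s. snd c (\<gamma> s)) has_vector_derivative \<xi>) (at t within J)"
    using path_chart_derivative[OF manifold_base \<gamma> c t(1) \<gamma>t] .
  have "\<eta> $ Inl i = \<xi> $ i" for i
  proof (rule vector_derivative_unique_within)
    show "at t within J \<noteq> bot"
      using at_within_interval_not_bot c1_pathD(1)[OF \<gamma>] t by blast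
    show "((\<lambda>s. snd c (\<gamma> s) $ i) has_vector_derivative \<xi> $ i) (at t within J)"
      by (rule bounded_linear.has_vector_derivative[OF bounded_linear_vec_nth \<xi>])
    have "((\<lambda>s. snd d (\<beta> s) $ Inl i) has_vector_derivative \<eta> $ Inl i) (at t within J)"
      by (rule bounded_linear.has_vector_derivative[OF bounded_linear_vec_nth \<eta>])
    moreover have "\<forall>\<^sub>F s in at t within J. snd d (\<beta> s) $ Inl i = snd c (\<gamma> s) $ i"
    proof -
      have "(\<beta> \<longlongrightarrow> \<beta> t) (at t within J)"
        using c1_pathD(2)[OF \<beta>] t by (simp add: continuous_on)
      then have "\<forall>\<^sub>F s in at t within J. \<beta> s \<in> fst d"
        using topological_tendstoD chart_open(1)[OF admissibleD(1)[OF d]] t(3) by blast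
      moreover have "\<forall>\<^sub>F s in at t within J. s \<in> J"
        by (simp add: eventually_at_filter)
      ultimately show ?thesis
        by eventually_elim (simp add: bundle_chartsD(4)[OF cd] pr)
    qed
    ultimately show "((\<lambda>s. snd c (\<gamma> s) $ i) has_vector_derivative \<eta> $ Inl i) (at t within J)"
      unfolding has_vector_derivative_def
      by (rule has_derivative_transform_eventually) (simp_all add: bundle_chartsD(4)[OF cd] pr t)
  qed
  then show thesis
    using that velocity_eq_tangent_of[OF manifold_total \<beta> d t \<eta>]
      velocity_eq_tangent_of[OF manifold_base \<gamma> c t(1,2) \<gamma>t \<xi>] by blast
qed

lemma velocity_const:
  assumes "is_interval J" "t \<in> J" "J \<noteq> {t}" "admissible_chart \<A>\<^sub>M c" "x \<in> fst c"
  shows "velocity \<A>\<^sub>M J (\<lambda>_. x) t = tangent_of \<A>\<^sub>M c x 0"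
  using assms by (intro velocity_eq_tangent_of[OF manifold_base] c1_path_const) auto

text \<open>A curve in a fibre lies over a constant path, so its velocity has no base components.
  Conversely, a coordinate line in such a direction keeps the base coordinates fixed and stays in
  the fibre because \<open>c\<close> is injective.\<close>

lemma vertical_space_coordinates:
  assumes cd: "bundle_charts c d" and p: "p \<in> fst d"
  shows "vertical_space \<A>\<^sub>E pr p = tangent_of \<A>\<^sub>E d p ` {\<eta>. \<forall>i. \<eta> $ Inl i = 0}"
proof safe
  have c: "admissible_chart \<A>\<^sub>M c" and d: "admissible_chart \<A>\<^sub>E d"
    using bundle_chartsD[OF cd] by simp_all
  have pc: "pr p \<in> fst c" by (rule bundle_chartsD(3)[OF cd p])
  {
    fix v assume "v \<in> vertical_space \<A>\<^sub>E pr p"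
    then obtain \<beta> \<epsilon> where v: "v = velocity \<A>\<^sub>E {-\<epsilon><..<\<epsilon>} \<beta> 0" and \<epsilon>: "\<epsilon> > 0"
      and \<beta>: "c1_path \<A>\<^sub>E {-\<epsilon><..<\<epsilon>} \<beta>" "\<beta> 0 = p" "\<And>s. s \<in> {-\<epsilon><..<\<epsilon>} \<Longrightarrow> pr (\<beta> s) = pr p"
      unfolding vertical_space_def by blast
    let ?J = "{-\<epsilon><..<\<epsilon>}"
    have J: "is_interval ?J" "0 \<in> ?J" "?J \<noteq> {0}"
      using \<epsilon> by (auto simp: is_interval_oo set_eq_iff intro!: exI[of _ "\<epsilon>/2"])
    obtain \<xi> \<eta> where 1: "velocity \<A>\<^sub>E ?J \<beta> 0 = tangent_of \<A>\<^sub>E d (\<beta> 0) \<eta>"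
      "velocity \<A>\<^sub>M ?J (\<lambda>_. pr p) 0 = tangent_of \<A>\<^sub>M c (pr p) \<xi>" "\<And>i. \<eta> $ Inl i = \<xi> $ i"
      using lift_velocity_coordinates[OF cd \<beta>(1) c1_path_const[OF J(1)] \<beta>(3) J(2,3)] \<beta>(2) p by metis
    have "\<xi> = 0"
      using 1(2) velocity_const[OF J c pc] inj_tangent_of[OF manifold_base c pc]
      by (simp add: inj_eq)
    then show "v \<in> tangent_of \<A>\<^sub>E d p ` {\<eta>. \<forall>i. \<eta> $ Inl i = 0}"
      using 1 v \<beta>(2) by auto
  next
    fix \<eta> :: "'k^('n + 'r)" assume \<eta>: "\<forall>i. \<eta> $ Inl i = 0"
    obtain \<beta> \<epsilon> where \<epsilon>: "\<epsilon> > 0" and \<beta>: "\<beta> 0 = p" "c1_path \<A>\<^sub>E {-\<epsilon><..<\<epsilon>} \<beta>"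
      "velocity \<A>\<^sub>E {-\<epsilon><..<\<epsilon>} \<beta> 0 = tangent_of \<A>\<^sub>E d p \<eta>"
      and line: "\<forall>t\<in>{-\<epsilon><..<\<epsilon>}. \<beta> t \<in> fst d \<and> snd d (\<beta> t) = snd d p + t *\<^sub>R \<eta>"
      using line_path[OF manifold_total d p, where \<xi> = \<eta>] .
    have "\<forall>t\<in>{-\<epsilon><..<\<epsilon>}. pr (\<beta> t) = pr p"
    proof
      fix t assume t: "t \<in> {-\<epsilon><..<\<epsilon>}"
      show "pr (\<beta> t) = pr p"
      proof (rule inj_onD[OF chart_inj[OF admissibleD(1)[OF c]] _ _ pc])
      show "pr (\<beta> t) \<in> fst c" using bundle_chartsD(3)[OF cd] bspec[OF line t] by blast
      have "snd c (pr (\<beta> t)) $ i = snd c (pr p) $ i" for i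
        using bspec[OF line t] \<eta> by (simp flip: bundle_chartsD(4)[OF cd] add: p)
      then show "snd c (pr (\<beta> t)) = snd c (pr p)" by (simp add: vec_eq_iff)
      qed
    qed
    then show "tangent_of \<A>\<^sub>E d p \<eta> \<in> vertical_space \<A>\<^sub>E pr p"
      unfolding vertical_space_def mem_Collect_eq using \<epsilon> \<beta> by metis
  }
qed

text \<open>In bundle coordinates the vertical space is the kernel of the projection to the base
  components. \<open>ex\<close> and \<open>zero\<close> make this projection onto and injective on
  \<open>H p\<close>, so \<open>H p\<close> is a complement of the kernel.\<close>

lemma horizontal_distributionI:
  assumes sub: "\<And>p. tangent.subspace (H p)" and H_sub: "\<And>p. H p \<subseteq> tangent_space \<A>\<^sub>E p"
    and ex: "\<And>c d p \<xi>. bundle_charts c d \<Longrightarrow> p \<in> fst d \<Longrightarrow>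
          \<exists>\<eta>. tangent_of \<A>\<^sub>E d p \<eta> \<in> H p \<and> (\<forall>i. \<eta> $ Inl i = \<xi> $ i)"
    and zero: "\<And>c d p \<eta>. bundle_charts c d \<Longrightarrow> p \<in> fst d \<Longrightarrow>
          tangent_of \<A>\<^sub>E d p \<eta> \<in> H p \<Longrightarrow> \<forall>i. \<eta> $ Inl i = 0 \<Longrightarrow> \<eta> = 0"
  shows "horizontal_distribution \<A>\<^sub>E pr H"
  unfolding horizontal_distribution_def
proof (intro allI conjI)
  fix p
  obtain c d where cd: "bundle_charts c d" and p: "p \<in> fst d"
    using bundle_charts_exist[of p] by blast
  have d: "admissible_chart \<A>\<^sub>E d" by (rule bundle_chartsD(2)[OF cd])
  let ?T = "tangent_of \<A>\<^sub>E d p"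
  note T_linear = tangent_of_linear[OF manifold_total d p]
  have T: "tangent_space \<A>\<^sub>E p = range ?T" by (rule tangent_space_eq_range[OF manifold_total d p])
  have V: "vertical_space \<A>\<^sub>E pr p = ?T ` {\<eta>. \<forall>i. \<eta> $ Inl i = 0}"
    by (rule vertical_space_coordinates[OF cd p])
  have T0: "?T 0 = 0" using T_linear(1)[of 0 0] by simp
  have T_diff: "?T (\<zeta> - \<eta>) = ?T \<zeta> - ?T \<eta>" for \<zeta> \<eta>
    using T_linear(1)[of "\<zeta> - \<eta>" \<eta>] by (simp add: algebra_simps)
  show "tangent.subspace (H p)" "H p \<subseteq> tangent_space \<A>\<^sub>E p" by (fact sub, fact H_sub)
  show "vertical_space \<A>\<^sub>E pr p \<inter> H p = {0}"
  proof safe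
    fix v assume "v \<in> vertical_space \<A>\<^sub>E pr p" "v \<in> H p"
    then obtain \<eta> where \<eta>: "v = ?T \<eta>" "\<forall>i. \<eta> $ Inl i = 0" using V by auto
    then have "\<eta> = 0" using zero[OF cd p] \<open>v \<in> H p\<close> by simp
    then show "v = 0" using \<eta> T0 by simp
  next
    show "0 \<in> vertical_space \<A>\<^sub>E pr p" unfolding V using T0 by (intro image_eqI[of _ _ 0]) auto
    show "0 \<in> H p" by (rule tangent.subspace_0[OF sub])
  qed
  show "{v + w | v w. v \<in> vertical_space \<A>\<^sub>E pr p \<and> w \<in> H p} = tangent_space \<A>\<^sub>E p"
  proof safe
    fix v w assume "v \<in> vertical_space \<A>\<^sub>E pr p" "w \<in> H p"
    then have "v \<in> range ?T" "w \<in> range ?T" using V H_sub[of p] T by auto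
    then show "v + w \<in> tangent_space \<A>\<^sub>E p" unfolding T by (auto simp flip: T_linear(1))
  next
    fix w assume "w \<in> tangent_space \<A>\<^sub>E p"
    then obtain \<zeta> where \<zeta>: "w = ?T \<zeta>" using T by auto
    \<comment> \<open>The horizontal part of \<open>w\<close> is the vector of \<open>H p\<close>
      with the same base components; the remainder is vertical.\<close>
    obtain \<eta> where \<eta>: "?T \<eta> \<in> H p" "\<forall>i. \<eta> $ Inl i = (\<chi> i. \<zeta> $ Inl i) $ i"
      using ex[OF cd p] by blast
    have "?T (\<zeta> - \<eta>) \<in> vertical_space \<A>\<^sub>E pr p" unfolding V using \<eta> by simp
    moreover have "w = ?T (\<zeta> - \<eta>) + ?T \<eta>" using \<zeta> T_diff by simp
    ultimately show "\<exists>v wa. w = v + wa \<and> v \<in> vertical_space \<A>\<^sub>E pr p \<and> wa \<in> H p"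
      using \<eta>(1) by blast
  qed
  show "tangent.dim (H p) = CARD('n)"
  proof -
    \<comment> \<open>\<open>L\<close> is horizontal lifting in coordinates: a section of the
      projection to the base components with values in \<open>H p\<close>. It is chosen pointwise
      and becomes linear through the uniqueness in \<open>L_eq\<close>.\<close>
    obtain L where L: "?T (L \<xi>) \<in> H p" "\<And>i. L \<xi> $ Inl i = \<xi> $ i" for \<xi>
      using ex[OF cd p] by metis
    have L_eq: "\<eta> = L \<xi>" if "?T \<eta> \<in> H p" "\<And>i. \<eta> $ Inl i = \<xi> $ i" for \<eta> \<xi>
    proof -
      have "?T (\<eta> - L \<xi>) \<in> H p" using tangent.subspace_diff[OF sub that(1) L(1)] by (simp add: T_diff)
      then have "\<eta> - L \<xi> = 0" by (rule zero[OF cd p]) (simp add: that L)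
      then show ?thesis by simp
    qed
    have add: "L (\<xi> + \<zeta>) = L \<xi> + L \<zeta>" for \<xi> \<zeta>
      by (rule L_eq[symmetric]) (auto simp: L T_linear intro: tangent.subspace_add[OF sub])
    have scale: "L (a *s \<xi>) = a *s L \<xi>" for a \<xi>
      by (rule L_eq[symmetric]) (auto simp: L T_linear intro: tangent.subspace_scale[OF sub])
    interpret F: Vector_Spaces.linear "(*s)" tscale "\<lambda>\<xi>. ?T (L \<xi>)"
      by unfold_locales (simp_all add: add scale T_linear)
    have "inj (\<lambda>\<xi>. ?T (L \<xi>))"
      using inj_tangent_of[OF manifold_total d p] by (auto intro!: injI simp: inj_eq vec_eq_iff dest: arg_cong[where f = "\<lambda>v. v $ Inl _"] simp flip: L(2))
    then have inj: "inj_on (\<lambda>\<xi>. ?T (L \<xi>)) S" for S by (rule inj_on_subset) simp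
    have range: "H p = range (\<lambda>\<xi>. ?T (L \<xi>))"
    proof safe
      fix w assume w: "w \<in> H p"
      then obtain \<eta> where \<eta>: "w = ?T \<eta>" using H_sub T by blast
      then have "\<eta> = L (\<chi> i. \<eta> $ Inl i)" using w by (intro L_eq) auto
      then show "w \<in> range (\<lambda>\<xi>. ?T (L \<xi>))" using \<eta> by (metis rangeI)
    qed (rule L)
    \<comment> \<open>The lifts of the standard basis vectors form a basis of
      \<open>H p\<close>.\<close>
    let ?B = "(\<lambda>\<xi>. ?T (L \<xi>)) ` cart_basis"
    have "tangent.independent ?B"
      using independent_cart_basis inj by (intro F.independent_injective_image)
    moreover have "tangent.span ?B = H p"
      unfolding F.span_image span_cart_basis range ..
    moreover have "card ?B = CARD('n)"
      using inj by (simp add: card_image card_cart_basis)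
    ultimately show ?thesis
      by (metis tangent.dim_span_eq_card_independent)
  qed
qed

end

section \<open>The connection of a parallel transport\<close>

context parallel_transport
begin

definition horizontal_space :: "'e \<Rightarrow> (('e,'k,'n + 'r) chart \<Rightarrow> 'k^('n + 'r)) set"
  where "horizontal_space p = {velocity \<A>\<^sub>E {\<sigma>..\<tau>} (transport_lift P \<sigma> \<gamma> p) \<sigma> | \<sigma> \<tau> \<gamma>.
    \<sigma> < \<tau> \<and> c1_path \<A>\<^sub>M {\<sigma>..\<tau>} \<gamma> \<and> pr p = \<gamma> \<sigma>}"

lemma horizontal_spaceI:
  "\<sigma> < \<tau> \<Longrightarrow> c1_path \<A>\<^sub>M {\<sigma>..\<tau>} \<gamma> \<Longrightarrow> pr p = \<gamma> \<sigma> \<Longrightarrow>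
    velocity \<A>\<^sub>E {\<sigma>..\<tau>} (transport_lift P \<sigma> \<gamma> p) \<sigma> \<in> horizontal_space p"
  unfolding horizontal_space_def by blast

lemma transport_lift_start: "pr p = \<gamma> \<sigma> \<Longrightarrow> transport_lift P \<sigma> \<gamma> p \<sigma> = p"
  by (simp add: transport_lift_def transport_trivial)

lemma pr_transport_lift:
  assumes "c1_path \<A>\<^sub>M {\<sigma>..\<tau>} \<gamma>" "pr p = \<gamma> \<sigma>" "s \<in> {\<sigma>..\<tau>}"
  shows "pr (transport_lift P \<sigma> \<gamma> p s) = \<gamma> s"
  unfolding transport_lift_def using assms
  by (intro transport_fibre c1_path_subset[OF assms(1)]) (auto simp: is_interval_cc)

lemma subspace_horizontal_space: "tangent.subspace (horizontal_space p)"
proof -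
  have comb: "tscale a v + tscale b w \<in> horizontal_space p"
    if vw: "v \<in> horizontal_space p" "w \<in> horizontal_space p" for a b v w
  proof -
    obtain \<sigma>1 \<tau>1 \<gamma>1 where 1: "\<sigma>1 < \<tau>1" "c1_path \<A>\<^sub>M {\<sigma>1..\<tau>1} \<gamma>1" "pr p = \<gamma>1 \<sigma>1"
      "v = velocity \<A>\<^sub>E {\<sigma>1..\<tau>1} (transport_lift P \<sigma>1 \<gamma>1 p) \<sigma>1"
      using vw(1) unfolding horizontal_space_def by blast
    obtain \<sigma>2 \<tau>2 \<gamma>2 where 2: "\<sigma>2 < \<tau>2" "c1_path \<A>\<^sub>M {\<sigma>2..\<tau>2} \<gamma>2" "pr p = \<gamma>2 \<sigma>2"
      "w = velocity \<A>\<^sub>E {\<sigma>2..\<tau>2} (transport_lift P \<sigma>2 \<gamma>2 p) \<sigma>2"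
      using vw(2) unfolding horizontal_space_def by blast
    have "\<gamma>1 \<sigma>1 = \<gamma>2 \<sigma>2" using 1 2 by simp
    from transport_lift_combination[OF 1(1,2) 2(1,2) this, of a b]
    obtain \<sigma>3 \<tau>3 \<gamma>3 where 3: "\<sigma>3 < \<tau>3" "c1_path \<A>\<^sub>M {\<sigma>3..\<tau>3} \<gamma>3" "\<gamma>3 \<sigma>3 = \<gamma>1 \<sigma>1"
      and v3: "\<And>p. pr p = \<gamma>3 \<sigma>3 \<Longrightarrow> velocity \<A>\<^sub>E {\<sigma>3..\<tau>3} (transport_lift P \<sigma>3 \<gamma>3 p) \<sigma>3 =
        tscale a (velocity \<A>\<^sub>E {\<sigma>1..\<tau>1} (transport_lift P \<sigma>1 \<gamma>1 p) \<sigma>1) +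
        tscale b (velocity \<A>\<^sub>E {\<sigma>2..\<tau>2} (transport_lift P \<sigma>2 \<gamma>2 p) \<sigma>2)"
      by blast
    have p3: "pr p = \<gamma>3 \<sigma>3" using 1 3 by simp
    show ?thesis
      using horizontal_spaceI[OF 3(1,2) p3] v3[OF p3] 1(4) 2(4) by simp
  qed
  \<comment> \<open>Any transported path through \<open>p\<close> shows nonemptiness; a constant
    base path will do.\<close>
  obtain v where v: "v \<in> horizontal_space p"
    using horizontal_spaceI[of 0 1 "\<lambda>_. pr p" p] c1_path_const[OF is_interval_cc] by fastforce
  show ?thesis
    \<comment> \<open>Coefficients \<open>0, 0\<close> give the zero vector, \<open>1, 1\<close>
      give sums, and a vanishing second coefficient gives multiples.\<close>
    unfolding tangent.subspace_def using comb[OF v v, of 0 0] comb[of _ _ 1 1] comb[of _ _ _ 0] by auto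
qed

lemma horizontal_space_subset: "horizontal_space p \<subseteq> tangent_space \<A>\<^sub>E p"
proof
  fix v assume "v \<in> horizontal_space p"
  then obtain \<sigma> \<tau> \<gamma> where *: "\<sigma> < \<tau>" "c1_path \<A>\<^sub>M {\<sigma>..\<tau>} \<gamma>" "pr p = \<gamma> \<sigma>"
    "v = velocity \<A>\<^sub>E {\<sigma>..\<tau>} (transport_lift P \<sigma> \<gamma> p) \<sigma>"
    unfolding horizontal_space_def by blast
  have "{\<sigma>..\<tau>} \<noteq> {\<sigma>}" using *(1) by auto
  then show "v \<in> tangent_space \<A>\<^sub>E p"
    using velocity_in_tangent_space[OF manifold_total transport_lift_c1[OF _ *(2,3)], of \<sigma>] *
      transport_lift_start[of p \<gamma> \<sigma>] by auto
qed

lemma horizontal_distribution_horizontal_space: "horizontal_distribution \<A>\<^sub>E pr horizontal_space"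
proof (rule horizontal_distributionI[OF subspace_horizontal_space horizontal_space_subset])
  fix c d p assume cd: "bundle_charts c d" and p: "p \<in> fst d"
  have c: "admissible_chart \<A>\<^sub>M c" and d: "admissible_chart \<A>\<^sub>E d"
    using bundle_chartsD[OF cd] by simp_all
  have pc: "pr p \<in> fst c" by (rule bundle_chartsD(3)[OF cd p])
  have lift: "\<exists>\<xi> \<eta>. velocity \<A>\<^sub>E {\<sigma>..\<tau>} (transport_lift P \<sigma> \<gamma> p) \<sigma> = tangent_of \<A>\<^sub>E d p \<eta> \<and>
      velocity \<A>\<^sub>M {\<sigma>..\<tau>} \<gamma> \<sigma> = tangent_of \<A>\<^sub>M c (pr p) \<xi> \<and> (\<forall>i. \<eta> $ Inl i = \<xi> $ i)"
    if \<gamma>: "\<sigma> < \<tau>" "c1_path \<A>\<^sub>M {\<sigma>..\<tau>} \<gamma>" "pr p = \<gamma> \<sigma>" for \<sigma> \<tau> \<gamma>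
  proof -
    have L: "c1_path \<A>\<^sub>E {\<sigma>..\<tau>} (transport_lift P \<sigma> \<gamma> p)" using \<gamma> by (intro transport_lift_c1) auto
    have "\<sigma> \<in> {\<sigma>..\<tau>}" "{\<sigma>..\<tau>} \<noteq> {\<sigma>}" "transport_lift P \<sigma> \<gamma> p \<sigma> \<in> fst d"
      using \<gamma>(1) transport_lift_start[of p \<gamma> \<sigma>] \<gamma>(3) p by auto
    from lift_velocity_coordinates[OF cd L \<gamma>(2) pr_transport_lift[OF \<gamma>(2,3)] this]
    show ?thesis using transport_lift_start[of p \<gamma> \<sigma>] \<gamma>(3) by metis
  qed
  {
    fix \<xi>
    obtain \<gamma> \<epsilon> where \<epsilon>: "\<epsilon> > 0" and \<gamma>: "\<gamma> 0 = pr p" "c1_path \<A>\<^sub>M {-\<epsilon><..<\<epsilon>} \<gamma>"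
      "velocity \<A>\<^sub>M {-\<epsilon><..<\<epsilon>} \<gamma> 0 = tangent_of \<A>\<^sub>M c (pr p) \<xi>"
      using line_path[OF manifold_base c pc, where \<xi> = \<xi>] .
    \<comment> \<open>Transport is defined along closed intervals, so the line is cut at
      \<open>0\<close>; its one-sided velocity there is the two-sided one.\<close>
    let ?J = "{0..\<epsilon>/2}"
    have J: "0 < \<epsilon>/2" "is_interval ?J" "?J \<subseteq> {-\<epsilon><..<\<epsilon>}" "0 \<in> ?J" "?J \<noteq> {0}"
      using \<epsilon> by (auto simp: is_interval_cc)
    have \<gamma>J: "c1_path \<A>\<^sub>M ?J \<gamma>" by (rule c1_path_subset[OF \<gamma>(2) J(2,3)])
    have v: "velocity \<A>\<^sub>M ?J \<gamma> 0 = tangent_of \<A>\<^sub>M c (pr p) \<xi>"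
      using velocity_subset[OF manifold_base \<gamma>(2) J(2-5)] \<gamma>(3) by simp
    from lift[OF J(1) \<gamma>J] \<gamma>(1) obtain \<xi>' \<eta>
      where "velocity \<A>\<^sub>E ?J (transport_lift P 0 \<gamma> p) 0 = tangent_of \<A>\<^sub>E d p \<eta>"
        "velocity \<A>\<^sub>M ?J \<gamma> 0 = tangent_of \<A>\<^sub>M c (pr p) \<xi>'" "\<forall>i. \<eta> $ Inl i = \<xi>' $ i" by metis
    moreover from this(2) have "\<xi>' = \<xi>"
      using v inj_tangent_of[OF manifold_base c pc] by (simp add: inj_eq)
    ultimately show "\<exists>\<eta>. tangent_of \<A>\<^sub>E d p \<eta> \<in> horizontal_space p \<and> (\<forall>i. \<eta> $ Inl i = \<xi> $ i)"
      using horizontal_spaceI[OF J(1) \<gamma>J] \<gamma>(1) by metis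
  next
    fix \<eta> assume \<eta>: "tangent_of \<A>\<^sub>E d p \<eta> \<in> horizontal_space p" "\<forall>i. \<eta> $ Inl i = 0"
    then obtain \<sigma> \<tau> \<gamma> where *: "\<sigma> < \<tau>" "c1_path \<A>\<^sub>M {\<sigma>..\<tau>} \<gamma>" "pr p = \<gamma> \<sigma>"
      and T: "tangent_of \<A>\<^sub>E d p \<eta> = velocity \<A>\<^sub>E {\<sigma>..\<tau>} (transport_lift P \<sigma> \<gamma> p) \<sigma>"
      unfolding horizontal_space_def by blast
    let ?J = "{\<sigma>..\<tau>}"
    have J: "is_interval ?J" "\<sigma> \<in> ?J" "?J \<noteq> {\<sigma>}" using *(1) by (auto simp: is_interval_cc)
    from lift[OF *] obtain \<xi> \<eta>' where
      "velocity \<A>\<^sub>E ?J (transport_lift P \<sigma> \<gamma> p) \<sigma> = tangent_of \<A>\<^sub>E d p \<eta>'"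
      and \<xi>: "velocity \<A>\<^sub>M ?J \<gamma> \<sigma> = tangent_of \<A>\<^sub>M c (pr p) \<xi>" "\<forall>i. \<eta>' $ Inl i = \<xi> $ i"
      by blast
    moreover from this(1) T have "\<eta>' = \<eta>"
      using inj_tangent_of[OF manifold_total d p] by (simp add: inj_eq)
    ultimately have "\<xi> = 0" using \<eta>(2) by (simp add: vec_eq_iff)
    \<comment> \<open>The base path starts with velocity zero, like the constant path, so axiom (v)
      identifies the initial velocities of their lifts.\<close>
    then have "velocity \<A>\<^sub>M ?J \<gamma> \<sigma> = velocity \<A>\<^sub>M ?J (\<lambda>_. pr p) \<sigma>"
      using \<xi>(1) velocity_const[OF J c pc] by simp
    then have "velocity \<A>\<^sub>E ?J (transport_lift P \<sigma> \<gamma> p) \<sigma> =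
        velocity \<A>\<^sub>E ?J (transport_lift P \<sigma> (\<lambda>_. pr p) p) \<sigma>"
      using * c1_path_const[OF J(1)] by (intro transport_lift_velocity) auto
    also have "\<dots> = velocity \<A>\<^sub>E ?J (\<lambda>_. p) \<sigma>"
      using J transport_const[of \<sigma> _ p]
      by (intro velocity_cong[OF manifold_total c1_path_const]) (auto simp: transport_lift_def)
    also have "\<dots> = tangent_of \<A>\<^sub>E d p 0"
      using J by (intro velocity_eq_tangent_of[OF manifold_total _ d] c1_path_const p) auto
    finally show "\<eta> = 0"
      using T inj_tangent_of[OF manifold_total d p] by (simp add: inj_eq)
  }
qed

end

section \<open>Horizontal lifts\<close>

lemma horizontal_distributionD:
  assumes "horizontal_distribution A pr H"
  shows "tangent.subspace (H p)" "H p \<subseteq> tangent_space A p" "vertical_space A pr p \<inter> H p = {0}"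
    and "tangent_space A p = {v + w | v w. v \<in> vertical_space A pr p \<and> w \<in> H p}"
  using assms by (simp_all add: horizontal_distribution_def)

lemma horizontal_lift_subset:
  assumes M: "c1_manifold A" and \<beta>: "horizontal_lift A pr H J \<gamma> \<beta>" and K: "is_interval K" "K \<subseteq> J"
  shows "horizontal_lift A pr H K \<gamma> \<beta>"
  unfolding horizontal_lift_def
proof (intro conjI ballI impI)
  have path: "c1_path A J \<beta>" using \<beta> by (simp add: horizontal_lift_def)
  show "c1_path A K \<beta>" by (rule c1_path_subset[OF path K])
  fix s assume s: "s \<in> K"
  then show "pr (\<beta> s) = \<gamma> s" using \<beta> K by (auto simp: horizontal_lift_def)
  assume ne: "K \<noteq> {s}"
  then have "J \<noteq> {s}" using s K by auto
  then have "velocity A J \<beta> s \<in> H (\<beta> s)" using \<beta> s K by (auto simp: horizontal_lift_def)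
  then show "velocity A K \<beta> s \<in> H (\<beta> s)" using velocity_subset[OF M path K s ne] by simp
qed

lemma horizontal_lift_cong:
  assumes M: "c1_manifold A" and \<beta>: "horizontal_lift A pr H J \<gamma> \<beta>"
    and eq: "\<And>s. s \<in> J \<Longrightarrow> \<beta>' s = \<beta> s"
  shows "horizontal_lift A pr H J \<gamma> \<beta>'"
proof -
  have path: "c1_path A J \<beta>" using \<beta> by (simp add: horizontal_lift_def)
  show ?thesis
    using \<beta> c1_path_cong[OF path eq] velocity_cong[OF M path eq] eq
    by (simp add: horizontal_lift_def)
qed

text \<open>The interval \<open>{a..b}\<close> extends beyond \<open>t\<close> on each side on which
  \<open>J\<close> does, which makes it a neighbourhood of \<open>t\<close> within \<open>J\<close>.
  The free points \<open>x\<close> and \<open>y\<close> are used for the starting point of a lift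
  and for a point distinct from \<open>t\<close>.\<close>

lemma interval_hull:
  fixes J :: "real set"
  assumes J: "is_interval J" and "x \<in> J" "y \<in> J" "t \<in> J"
  obtains a b e where "{a..b} \<subseteq> J" "{x, y, t} \<subseteq> {a..b}" "e > 0" "J \<inter> ball t e \<subseteq> {a..b}"
proof -
  define m where "m = min x (min y t)"
  define M where "M = max x (max y t)"
  have mM: "m \<in> J" "M \<in> J" using assms by (auto simp: m_def M_def min_def max_def)
  obtain a where a: "a \<in> J" "a \<le> m" "a < t \<or> (\<forall>z\<in>J. a \<le> z)"
  proof (cases "\<exists>z\<in>J. z < m")
    case True
    then obtain z where "z \<in> J" "z < m" by blast
    moreover have "m \<le> t" by (simp add: m_def)
    ultimately show thesis by (intro that[of z]) auto
  next
    case False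
    then show thesis using mM(1) by (intro that[of m]) force+
  qed
  obtain b where b: "b \<in> J" "M \<le> b" "t < b \<or> (\<forall>z\<in>J. z \<le> b)"
  proof (cases "\<exists>z\<in>J. M < z")
    case True
    then obtain z where "z \<in> J" "M < z" by blast
    moreover have "t \<le> M" by (simp add: M_def)
    ultimately show thesis by (intro that[of z]) auto
  next
    case False
    then show thesis using mM(2) by (intro that[of M]) force+
  qed
  have "{a..b} \<subseteq> J"
    using J a(1) b(1) by (meson atLeastAtMost_iff mem_is_interval_1_I subsetI)
  moreover have "{x, y, t} \<subseteq> {a..b}" using a(2) b(2) by (auto simp: m_def M_def)
  \<comment> \<open>If \<open>t\<close> is an endpoint of \<open>J\<close>, that side imposes no
    bound, and \<open>1\<close> is an arbitrary default.\<close>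
  moreover define e where "e = min (if a < t then t - a else 1) (if t < b then b - t else 1)"
  moreover have "e > 0" by (auto simp: e_def)
  moreover have "J \<inter> ball t e \<subseteq> {a..b}"
  proof
    fix z assume "z \<in> J \<inter> ball t e"
    then have z: "z \<in> J" "\<bar>t - z\<bar> < e" by (auto simp: dist_real_def)
    then have "a \<le> z" using a(3) by (auto simp: e_def split: if_splits)
    moreover have "z \<le> b" using z b(3) by (auto simp: e_def split: if_splits)
    ultimately show "z \<in> {a..b}" by simp
  qed
  ultimately show thesis using that by blast
qed

context parallel_transport
begin

lemma carries_transport_horizontal_space:
  "carries_transport \<A>\<^sub>M \<A>\<^sub>E pr horizontal_space P"
  unfolding carries_transport_def
proof (intro allI impI, elim conjE)
  fix \<sigma> \<tau> \<gamma> p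
  assume st: "\<sigma> \<le> \<tau>" and \<gamma>: "c1_path \<A>\<^sub>M {\<sigma>..\<tau>} \<gamma>" and p: "pr p = \<gamma> \<sigma>"
  let ?L = "transport_lift P \<sigma> \<gamma> p"
  have L: "c1_path \<A>\<^sub>E {\<sigma>..\<tau>} ?L" by (rule transport_lift_c1[OF st \<gamma> p])
  have sub: "c1_path \<A>\<^sub>M {a..b} \<gamma>" if "\<sigma> \<le> a" "b \<le> \<tau>" for a b
    using that by (intro c1_path_subset[OF \<gamma>]) (auto simp: is_interval_cc)
  show "horizontal_lift \<A>\<^sub>E pr horizontal_space {\<sigma>..\<tau>} \<gamma> ?L"
    unfolding horizontal_lift_def
  proof (intro conjI ballI impI L)
    fix s assume s: "s \<in> {\<sigma>..\<tau>}"
    show prs: "pr (?L s) = \<gamma> s" by (rule pr_transport_lift[OF \<gamma> p s])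
    assume ne: "{\<sigma>..\<tau>} \<noteq> {s}"
    show "velocity \<A>\<^sub>E {\<sigma>..\<tau>} ?L s \<in> horizontal_space (?L s)"
    proof (cases "s < \<tau>")
      case True
      let ?K = "{s..\<tau>}"
      have K: "?K \<subseteq> {\<sigma>..\<tau>}" "s \<in> ?K" "?K \<noteq> {s}" using True s by auto
      have "velocity \<A>\<^sub>E {\<sigma>..\<tau>} ?L s = velocity \<A>\<^sub>E ?K ?L s"
        using velocity_subset[OF manifold_total L is_interval_cc K] by simp
      \<comment> \<open>By \<open>transport_comp\<close>, the lift from \<open>s\<close> onwards is
        the transport lift that starts at \<open>?L s\<close>, so its velocity at \<open>s\<close>
        is an initial one.\<close>
      also have "\<dots> = velocity \<A>\<^sub>E ?K (transport_lift P s \<gamma> (?L s)) s"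
      proof (rule velocity_cong[OF manifold_total, symmetric])
        show "c1_path \<A>\<^sub>E ?K ?L" by (rule c1_path_subset[OF L is_interval_cc K(1)])
        show "transport_lift P s \<gamma> (?L s) t = ?L t" if "t \<in> ?K" for t
          unfolding transport_lift_def using that s by (intro transport_comp sub p) auto
      qed (use K in auto)
      also have "\<dots> \<in> horizontal_space (?L s)"
        using True s by (intro horizontal_spaceI sub prs) auto
      finally show ?thesis .
    next
      case False
      then have s: "s = \<tau>" "\<sigma> < \<tau>" using s ne by auto
      let ?K = "{- \<tau>..- \<sigma>}" and ?\<gamma> = "\<lambda>u. \<gamma> (- u)"
      have \<gamma>m: "c1_path \<A>\<^sub>M ?K ?\<gamma>" using c1_path_uminus[OF \<gamma>] by simp
      have prL: "pr (?L \<tau>) = ?\<gamma> (- \<tau>)" using prs s by simp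
      have Lm: "c1_path \<A>\<^sub>E ?K (\<lambda>u. ?L (- u))" using c1_path_uminus[OF L] by simp
      have K: "- \<tau> \<in> ?K" "?K \<noteq> {- \<tau>}" "{\<sigma>..\<tau>} \<noteq> {- (- \<tau>)}" using s by auto
      \<comment> \<open>At the right endpoint the reversed lift starts at \<open>?L \<tau>\<close>.
        Its initial velocity is minus the wanted one, and the sign is removed because horizontal
        spaces are subspaces.\<close>
      have "tscale (of_real (- 1)) (velocity \<A>\<^sub>E {\<sigma>..\<tau>} ?L (- (- \<tau>))) = velocity \<A>\<^sub>E ?K (\<lambda>u. ?L (- u)) (- \<tau>)"
        by (rule velocity_compose[where \<theta> = uminus, OF manifold_total L is_interval_cc _ K, symmetric])
          (auto intro!: derivative_eq_intros)
      also have "\<dots> = velocity \<A>\<^sub>E ?K (transport_lift P (- \<tau>) ?\<gamma> (?L \<tau>)) (- \<tau>)"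
        using transport_lift_uminus[OF \<gamma> p]
        by (intro velocity_cong[OF manifold_total Lm, symmetric] K(1,2)) (simp add: transport_lift_def)
      also have "\<dots> \<in> horizontal_space (?L \<tau>)"
        using s by (intro horizontal_spaceI \<gamma>m prL) auto
      finally have "- velocity \<A>\<^sub>E {\<sigma>..\<tau>} ?L \<tau> \<in> horizontal_space (?L \<tau>)" by simp
      from tangent.subspace_neg[OF subspace_horizontal_space this] show ?thesis by (simp add: s)
    qed
  qed
qed

lemma lifts_exist_horizontal_space: "lifts_exist \<A>\<^sub>M \<A>\<^sub>E pr horizontal_space"
  unfolding lifts_exist_def
proof (intro allI impI, elim conjE)
  fix J \<gamma> s0 p
  assume \<gamma>: "c1_path \<A>\<^sub>M J \<gamma>" and s0: "s0 \<in> J" and p: "pr p = \<gamma> s0"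
  have J: "is_interval J" by (rule c1_pathD(1)[OF \<gamma>])
  let ?\<gamma> = "\<lambda>u. \<gamma> (- u)"
  \<comment> \<open>Forward transport to the right of \<open>s0\<close>; to the left, forward
    transport along the reflected path.\<close>
  define \<beta> where "\<beta> = (\<lambda>s. if s0 \<le> s then P s0 s \<gamma> p else P (- s0) (- s) ?\<gamma> p)"
  have lift: "horizontal_lift \<A>\<^sub>E pr horizontal_space {a..b} \<gamma> \<beta>"
    if ab: "{a..b} \<subseteq> J" "a \<le> s0" "s0 \<le> b" for a b
  proof -
    have sub: "c1_path \<A>\<^sub>M {x..y} \<gamma>" if "a \<le> x" "y \<le> b" for x y
      using that ab by (intro c1_path_subset[OF \<gamma>]) (auto simp: is_interval_cc)
    have \<gamma>m: "c1_path \<A>\<^sub>M {- s0..- a} ?\<gamma>" using c1_path_uminus[OF sub[of a s0]] ab by simp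
    have pm: "pr p = ?\<gamma> (- s0)" using p by simp
    \<comment> \<open>\<open>q\<close> is the point over \<open>a\<close> that is reached by going
      back from \<open>p\<close>. On \<open>{a..b}\<close> the two halves of \<open>\<beta>\<close>
      combine into the single transport lift that starts at \<open>q\<close>.\<close>
    define q where "q = P (- s0) (- a) ?\<gamma> p"
    have q: "pr q = \<gamma> a"
      unfolding q_def using transport_fibre[OF _ \<gamma>m pm] ab by simp
    \<comment> \<open>Reflecting twice gives back \<open>\<gamma>\<close>, so
      \<open>transport_lift_uminus\<close> for the reflected path describes the lift from
      \<open>q\<close> up to \<open>s0\<close>.\<close>
    have below: "P a s \<gamma> q = P (- s0) (- s) ?\<gamma> p" if "s \<in> {a..s0}" for s
      using transport_lift_uminus[OF \<gamma>m pm, of s] that by (simp add: transport_lift_def q_def)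
    have "\<beta> s = transport_lift P a \<gamma> q s" if "s \<in> {a..b}" for s
    proof (cases "s0 \<le> s")
      case True
      have "P a s0 \<gamma> q = p" using below[of s0] ab transport_trivial[of p ?\<gamma> "- s0"] pm by simp
      then show ?thesis
        using transport_comp[of a s0 s \<gamma> q] sub[of a s] q ab that True by (simp add: \<beta>_def transport_lift_def)
    next
      case False
      then show ?thesis using below[of s] that by (simp add: \<beta>_def transport_lift_def)
    qed
    moreover have "horizontal_lift \<A>\<^sub>E pr horizontal_space {a..b} \<gamma> (transport_lift P a \<gamma> q)"
      using carries_transport_horizontal_space sub[of a b] q ab unfolding carries_transport_def by auto
    ultimately show ?thesis by (rule horizontal_lift_cong[OF manifold_total, rotated])
  qed
  have hull: "\<exists>a b e. {a..b} \<subseteq> J \<and> {s0, t', t} \<subseteq> {a..b} \<and> e > 0 \<and> J \<inter> ball t e \<subseteq> {a..b} \<and>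
      horizontal_lift \<A>\<^sub>E pr horizontal_space {a..b} \<gamma> \<beta>" if t: "t' \<in> J" "t \<in> J" for t t'
  proof -
    obtain a b e where "{a..b} \<subseteq> J" "{s0, t', t} \<subseteq> {a..b}" "e > 0" "J \<inter> ball t e \<subseteq> {a..b}"
      using interval_hull[OF J s0 t] .
    moreover from this have "horizontal_lift \<A>\<^sub>E pr horizontal_space {a..b} \<gamma> \<beta>"
      by (intro lift) auto
    ultimately show ?thesis by blast
  qed
  have path: "c1_path \<A>\<^sub>E J \<beta>"
  proof (rule c1_path_local[OF J])
    fix t assume t: "t \<in> J"
    obtain a b e where "{a..b} \<subseteq> J" "{s0, t, t} \<subseteq> {a..b}" "e > 0" "J \<inter> ball t e \<subseteq> {a..b}"
      "horizontal_lift \<A>\<^sub>E pr horizontal_space {a..b} \<gamma> \<beta>"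
      using hull[OF t t] by blast
    then show "\<exists>K e. t \<in> K \<and> K \<subseteq> J \<and> c1_path \<A>\<^sub>E K \<beta> \<and> e > 0 \<and> J \<inter> ball t e \<subseteq> K"
      unfolding horizontal_lift_def by (intro exI[of _ "{a..b}"] exI[of _ e]) simp
  qed
  have "horizontal_lift \<A>\<^sub>E pr horizontal_space J \<gamma> \<beta>"
    unfolding horizontal_lift_def
  proof (intro conjI ballI impI path)
    fix t assume t: "t \<in> J"
    obtain a b e where K: "{a..b} \<subseteq> J" "{s0, t, t} \<subseteq> {a..b}" "e > 0" "J \<inter> ball t e \<subseteq> {a..b}"
      "horizontal_lift \<A>\<^sub>E pr horizontal_space {a..b} \<gamma> \<beta>"
      using hull[OF t t] by blast
    then show "pr (\<beta> t) = \<gamma> t" unfolding horizontal_lift_def by simp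
  next
    fix t assume t: "t \<in> J" and ne: "J \<noteq> {t}"
    \<comment> \<open>A second point in the subinterval keeps it nondegenerate, so that it carries a
      velocity at \<open>t\<close>.\<close>
    then obtain t' where t': "t' \<in> J" "t' \<noteq> t" by blast
    obtain a b e where K: "{a..b} \<subseteq> J" "{s0, t', t} \<subseteq> {a..b}" "e > 0" "J \<inter> ball t e \<subseteq> {a..b}"
      "horizontal_lift \<A>\<^sub>E pr horizontal_space {a..b} \<gamma> \<beta>"
      using hull[OF t'(1) t] by blast
    have in_K: "t \<in> {a..b}" and ne_K: "{a..b} \<noteq> {t}" using K(2) t'(2) by auto
    then have "velocity \<A>\<^sub>E {a..b} \<beta> t \<in> horizontal_space (\<beta> t)"
      using K(5) unfolding horizontal_lift_def by blast
    then show "velocity \<A>\<^sub>E J \<beta> t \<in> horizontal_space (\<beta> t)"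
      using velocity_subset[OF manifold_total path is_interval_cc K(1) in_K ne_K] by simp
  qed
  moreover have "\<beta> s0 = p" using transport_trivial[of p \<gamma> s0] p by (simp add: \<beta>_def)
  ultimately show "\<exists>\<beta>. horizontal_lift \<A>\<^sub>E pr horizontal_space J \<gamma> \<beta> \<and> \<beta> s0 = p" by blast
qed

end

section \<open>Generated transport and uniqueness of the connection\<close>

context c1_bundle
begin

text \<open>Uniqueness of lifts makes the description in \<open>generated_transport\<close>
  definite, so any one lift computes it.\<close>

lemma generated_transport_eq:
  assumes "lifts_unique \<A>\<^sub>M \<A>\<^sub>E pr \<Delta>" "c1_path \<A>\<^sub>M {\<sigma>..\<tau>} \<gamma>" "\<sigma> \<le> \<tau>"
    and "horizontal_lift \<A>\<^sub>E pr \<Delta> {\<sigma>..\<tau>} \<gamma> \<beta>" "\<beta> \<sigma> = p"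
  shows "generated_transport \<A>\<^sub>E pr \<Delta> \<sigma> \<tau> \<gamma> p = \<beta> \<tau>"
  unfolding generated_transport_def
proof (rule the_equality)
  show "\<exists>\<beta>'. horizontal_lift \<A>\<^sub>E pr \<Delta> {\<sigma>..\<tau>} \<gamma> \<beta>' \<and> \<beta>' \<sigma> = p \<and> \<beta>' \<tau> = \<beta> \<tau>"
    using assms by blast
  fix q assume "\<exists>\<beta>'. horizontal_lift \<A>\<^sub>E pr \<Delta> {\<sigma>..\<tau>} \<gamma> \<beta>' \<and> \<beta>' \<sigma> = p \<and> \<beta>' \<tau> = q"
  then obtain \<beta>' where \<beta>': "horizontal_lift \<A>\<^sub>E pr \<Delta> {\<sigma>..\<tau>} \<gamma> \<beta>'" "\<beta>' \<sigma> = p" "\<beta>' \<tau> = q"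
    by blast
  have "\<sigma> \<in> {\<sigma>..\<tau>}" "\<tau> \<in> {\<sigma>..\<tau>}" using assms by auto
  then show "q = \<beta> \<tau>"
    using assms \<beta>' unfolding lifts_unique_def by metis
qed

end

context parallel_transport
begin

lemma generates_horizontal_space:
  assumes "lifts_unique \<A>\<^sub>M \<A>\<^sub>E pr horizontal_space"
  shows "generates \<A>\<^sub>M \<A>\<^sub>E pr horizontal_space P"
  unfolding generates_def
proof (intro allI impI, elim conjE)
  fix \<sigma> \<tau> \<gamma> p
  assume *: "\<sigma> \<le> \<tau>" "c1_path \<A>\<^sub>M {\<sigma>..\<tau>} \<gamma>" "pr p = \<gamma> \<sigma>"
  have "horizontal_lift \<A>\<^sub>E pr horizontal_space {\<sigma>..\<tau>} \<gamma> (transport_lift P \<sigma> \<gamma> p)"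
    using carries_transport_horizontal_space * unfolding carries_transport_def by blast
  from generated_transport_eq[OF assms *(2,1) this transport_lift_start[where \<gamma> = \<gamma>, OF *(3)]]
  show "generated_transport \<A>\<^sub>E pr horizontal_space \<sigma> \<tau> \<gamma> p = P \<sigma> \<tau> \<gamma> p"
    by (simp add: transport_lift_def)
qed

lemma connection_eq_horizontal_space:
  assumes conn: "connection \<A>\<^sub>M \<A>\<^sub>E pr \<Delta>" and gen: "generates \<A>\<^sub>M \<A>\<^sub>E pr \<Delta> P"
  shows "\<Delta> = horizontal_space"
proof
  fix p
  have \<Delta>: "horizontal_distribution \<A>\<^sub>E pr \<Delta>" and ex: "lifts_exist \<A>\<^sub>M \<A>\<^sub>E pr \<Delta>"
    and un: "lifts_unique \<A>\<^sub>M \<A>\<^sub>E pr \<Delta>"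
    using conn by (auto simp: connection_def)
  have sub: "horizontal_space p \<subseteq> \<Delta> p"
  proof
    fix v assume "v \<in> horizontal_space p"
    then obtain \<sigma> \<tau> \<gamma> where st: "\<sigma> < \<tau>" and \<gamma>: "c1_path \<A>\<^sub>M {\<sigma>..\<tau>} \<gamma>" and p: "pr p = \<gamma> \<sigma>"
      and v: "v = velocity \<A>\<^sub>E {\<sigma>..\<tau>} (transport_lift P \<sigma> \<gamma> p) \<sigma>"
      unfolding horizontal_space_def by blast
    have \<sigma>: "\<sigma> \<in> {\<sigma>..\<tau>}" "{\<sigma>..\<tau>} \<noteq> {\<sigma>}" using st by auto
    obtain \<beta> where \<beta>: "horizontal_lift \<A>\<^sub>E pr \<Delta> {\<sigma>..\<tau>} \<gamma> \<beta>" "\<beta> \<sigma> = p"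
      using ex \<gamma> p \<sigma>(1) unfolding lifts_exist_def by metis
    have path: "c1_path \<A>\<^sub>E {\<sigma>..\<tau>} \<beta>" using \<beta>(1) by (simp add: horizontal_lift_def)
    have "transport_lift P \<sigma> \<gamma> p s = \<beta> s" if s: "s \<in> {\<sigma>..\<tau>}" for s
    proof -
      have K: "{\<sigma>..s} \<subseteq> {\<sigma>..\<tau>}" "\<sigma> \<le> s" using s by auto
      have \<gamma>s: "c1_path \<A>\<^sub>M {\<sigma>..s} \<gamma>" by (rule c1_path_subset[OF \<gamma> is_interval_cc K(1)])
      \<comment> \<open>Generation only speaks of endpoints; applied to every initial piece
        \<open>{\<sigma>..s}\<close> it determines the whole lift.\<close>
      have "P \<sigma> s \<gamma> p = generated_transport \<A>\<^sub>E pr \<Delta> \<sigma> s \<gamma> p"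
        using gen \<gamma>s p K(2) unfolding generates_def by metis
      also have "\<dots> = \<beta> s"
        by (rule generated_transport_eq[OF un \<gamma>s K(2) horizontal_lift_subset[OF manifold_total \<beta>(1) is_interval_cc K(1)] \<beta>(2)])
      finally show ?thesis by (simp add: transport_lift_def)
    qed
    then have "v = velocity \<A>\<^sub>E {\<sigma>..\<tau>} \<beta> \<sigma>"
      unfolding v by (rule velocity_cong[OF manifold_total path _ \<sigma>])
    then show "v \<in> \<Delta> p" using \<beta> \<sigma> unfolding horizontal_lift_def by blast
  qed
  moreover have "\<Delta> p \<subseteq> horizontal_space p"
  proof
    fix w assume w: "w \<in> \<Delta> p"
    then have "w \<in> tangent_space \<A>\<^sub>E p" using horizontal_distributionD(2)[OF \<Delta>] by blast
    \<comment> \<open>The vertical part of \<open>w\<close> is the difference of two vectors of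
      \<open>\<Delta> p\<close>, hence horizontal for \<open>\<Delta>\<close> as well, and therefore
      zero.\<close>
    then obtain v h where vh: "w = v + h" "v \<in> vertical_space \<A>\<^sub>E pr p" "h \<in> horizontal_space p"
      using horizontal_distributionD(4)[OF horizontal_distribution_horizontal_space, of p] by auto
    have "tangent.subspace (\<Delta> p)" by (rule horizontal_distributionD(1)[OF \<Delta>])
    then have "w - h \<in> \<Delta> p" using w vh(3) sub by (intro tangent.subspace_diff) auto
    then have "v \<in> vertical_space \<A>\<^sub>E pr p \<inter> \<Delta> p" using vh by simp
    then have "v = 0" using horizontal_distributionD(3)[OF \<Delta>] by blast
    then show "w \<in> horizontal_space p" using vh by simp
  qed
  ultimately show "\<Delta> p = horizontal_space p" by blast
qed

end

theorem theorem7p4: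
  fixes \<A>\<^sub>M :: "('m::t2_space, 'k::{real_normed_field,euclidean_space}, 'n::finite) chart set"
    and \<A>\<^sub>E :: "('e::t2_space, 'k, 'n + 'r::finite) chart set"
    and pr :: "'e \<Rightarrow> 'm"
    and P :: "real \<Rightarrow> real \<Rightarrow> (real \<Rightarrow> 'm) \<Rightarrow> 'e \<Rightarrow> 'e"
  assumes "parallel_transport \<A>\<^sub>M \<A>\<^sub>E pr P"
    and "\<And>\<Delta>. horizontal_distribution \<A>\<^sub>E pr \<Delta> \<Longrightarrow> carries_transport \<A>\<^sub>M \<A>\<^sub>E pr \<Delta> P \<Longrightarrow> lifts_unique \<A>\<^sub>M \<A>\<^sub>E pr \<Delta>"
  shows "\<exists>!\<Delta>. connection \<A>\<^sub>M \<A>\<^sub>E pr \<Delta> \<and> generates \<A>\<^sub>M \<A>\<^sub>E pr \<Delta> P"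
proof -
  interpret parallel_transport \<A>\<^sub>M \<A>\<^sub>E pr P by (rule assms(1))
  \<comment> \<open>The convention on unique lifts is invoked for this one distribution; a competing
    connection brings its own uniqueness through \<open>connection\<close>.\<close>
  have unique: "lifts_unique \<A>\<^sub>M \<A>\<^sub>E pr horizontal_space"
    by (rule assms(2)[OF horizontal_distribution_horizontal_space carries_transport_horizontal_space])
  show ?thesis
  proof (rule ex1I)
    show "connection \<A>\<^sub>M \<A>\<^sub>E pr horizontal_space \<and> generates \<A>\<^sub>M \<A>\<^sub>E pr horizontal_space P"
      using horizontal_distribution_horizontal_space lifts_exist_horizontal_space unique
        generates_horizontal_space by (simp add: connection_def)
  qed (use connection_eq_horizontal_space in blast)
qed

end
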